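(* Fix a facet $\mathcal F^{(\ell)}$ of the capacity region $\mathcal C$ and a vector $\boldsymbol r^{(\ell)}$ in the relative interior of $\mathcal F^{(\ell)}$, and consider the family of generalized switches operating under the MaxWeight algorithm, parametrized by $\epsilon\in(0,1)$, described in the context. For each $\epsilon$ let $\overline{\boldsymbol q}^{(\epsilon)}$ be a steady-state random vector such that $\{\boldsymbol q^{(\epsilon)}(k):k\ge1\}$ converges in distribution to $\overline{\boldsymbol q}^{(\epsilon)}$. Suppose that $\lim_{\epsilon\downarrow0}\mathrm{Cov}[a_i^{(\epsilon)},a_j^{(\epsilon)}]=\mathrm{Cov}[a_i,a_j]$ for all $i,j\in\{1,\dots,n\}$ (where $\mathrm{Cov}[a_i,a_j]$ denotes the limit). Then, as $\epsilon\downarrow0$, $\epsilon\overline{\boldsymbol q}^{(\epsilon)}$ converges in distribution to $\overline\Upsilon\,\boldsymbol c^{(\ell)}$, where $\overline\Upsilon$ is an exponential random variable with mean $$\frac12\Big(\sum_{i=1}^n\sum_{j=1}^n c_i^{(\ell)}c_j^{(\ell)}\mathrm{Cov}[a_i,a_j]+\sigma_{B_\ell}^2\Big),$$ with $c_i^{(\ell)}$ the $i$-th element of $\boldsymbol c^{(\ell)}$.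
   Context: Generalized switch: a discrete-time system with $n$ queues. $q_i^{(\epsilon)}(k)$ is the number of jobs in queue $i$ at the beginning of slot $k\ge1$. The arrival vectors $\boldsymbol a^{(\epsilon)}(k)$, $k\ge1$, are i.i.d. over $k$ (components may be correlated), with nonnegative integer components bounded by a finite constant $A_{\max}$ (not depending on $\epsilon$), independent of the queue lengths. The channel states $\{T(k):k\ge1\}$ are i.i.d. with values in a finite set $\mathcal T$, independent of the queue length and arrival processes, with $\psi_t=P[T(1)=t]$. For each $t\in\mathcal T$, $\mathcal S^{(t)}$ is the finite set of feasible service rate vectors (nonnegative vectors) under channel state $t$. All nonnegative vectors dominated componentwise by a feasible vector are feasible as well, but $\mathcal S^{(t)}$ is taken to contain only the maximal feasible vectors and their projections on the coordinate axes. In slot $k$, if $T(k)=t$, the MaxWeight algorithm selects the potential service vector $\boldsymbol s^{(\epsilon)}(k)\in\arg\max_{\boldsymbol x\in\mathcal S^{(t)}}\langle\boldsymbol x,\boldsymbol q^{(\epsilon)}(k)\rangle$, ties broken at random. The dynamics are $q_i^{(\epsilon)}(k+1)=\max\{q_i^{(\epsilon)}(k)+a_i^{(\epsilon)}(k)-s_i^{(\epsilon)}(k),0\}$. The capacity region is $\mathcal C=\sum_{t\in\mathcal T}\psi_t\,\mathrm{ConvexHull}(\mathcal S^{(t)})$, a coordinate convex polytope, described with the minimal number $L$ of half-spaces as $\mathcal C=\{\boldsymbol x\in\mathbb R_+^n:\langle\boldsymbol c^{(\ell)},\boldsymbol x\rangle\le b^{(\ell)},\ \ell=1,\dots,L\}$,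 where $\boldsymbol c^{(\ell)}\ge\boldsymbol 0$, $\|\boldsymbol c^{(\ell)}\|=1$ (Euclidean norm) and $b^{(\ell)}>0$. The $\ell$-th facet is $\mathcal F^{(\ell)}=\{\boldsymbol x\in\mathcal C:\langle\boldsymbol c^{(\ell)},\boldsymbol x\rangle=b^{(\ell)}\}$. For $t\in\mathcal T$ let $b^{(t,\ell)}=\max_{\boldsymbol s\in\mathcal S^{(t)}}\langle\boldsymbol c^{(\ell)},\boldsymbol s\rangle$; $B_\ell(1)$ is a random variable that takes value $b^{(t,\ell)}$ with probability $\psi_t$ (i.e. the value corresponding to a random channel state), and $\sigma_{B_\ell}^2=\mathrm{Var}[B_\ell(1)]$. Heavy-traffic parametrization: for $\epsilon\in(0,1)$, $E[\boldsymbol a^{(\epsilon)}(k)]=\boldsymbol r^{(\ell)}-\epsilon\boldsymbol c^{(\ell)}$, and $\mathrm{Cov}[a_i^{(\epsilon)},a_j^{(\epsilon)}]$ is the covariance of $a_i^{(\epsilon)}(1)$ and $a_j^{(\epsilon)}(1)$; the service structure does not depend on $\epsilon$. *)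

theory Defs
  imports "HOL-Probability.Probability"
begin

section \<open>Weak convergence, covariance, exponential laws\<close>

definition converges_weakly ::
    "('i \<Rightarrow> 'a::topological_space measure) \<Rightarrow> 'a measure \<Rightarrow> 'i filter \<Rightarrow> bool" where
  "converges_weakly \<mu> \<nu> F \<longleftrightarrow>
     (\<forall>f :: 'a \<Rightarrow> real. continuous_on UNIV f \<longrightarrow> bounded (range f) \<longrightarrow>
        ((\<lambda>i. \<integral>x. f x \<partial>\<mu> i) \<longlongrightarrow> (\<integral>x. f x \<partial>\<nu>)) F)"

definition covariance :: "'w measure \<Rightarrow> ('w \<Rightarrow> real) \<Rightarrow> ('w \<Rightarrow> real) \<Rightarrow> real" where
  "covariance M X Y =
     (\<integral>\<omega>. (X \<omega> - (\<integral>\<omega>'. X \<omega>' \<partial>M)) * (Y \<omega> - (\<integral>\<omega>'. Y \<omega>' \<partial>M)) \<partial>M)"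

text \<open>The library's densities are indexed by the rate, which is the reciprocal of the mean \<open>m\<close>.
  The exponential law with mean \<open>0\<close> (no randomness left in the limit) is the unit mass at \<open>0\<close>.\<close>

definition exponential_law :: "real \<Rightarrow> real measure" where
  "exponential_law m =
     (if m > 0 then density lborel (exponential_density (1 / m)) else return borel 0)"


section \<open>Service structure and capacity region\<close>

definition coord_proj :: "'n set \<Rightarrow> real ^ 'n \<Rightarrow> real ^ 'n" where
  "coord_proj J v = (\<chi> i. if i \<in> J then v $ i else 0)"

definition maximal_vectors :: "(real ^ 'n) set \<Rightarrow> (real ^ 'n) set" where
  "maximal_vectors A = {v \<in> A. \<forall>w\<in>A. v \<le> w \<longrightarrow> w = v}"

text \<open>The order on vectors is componentwise. Every set of service vectors consists of its maximal
  vectors and of their projections on all coordinate subspaces, that is, of all vectors that arise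
  from a maximal one by setting an arbitrary set of components to \<open>0\<close>. Projecting on the
  one-dimensional axes alone would not make the convex hulls coordinate convex.\<close>

locale service_structure =
  fixes \<T> :: "'t set"
    and S :: "'t \<Rightarrow> (real ^ 'n) set"
    and \<psi> :: "'t pmf"
  assumes finite_channels: "finite \<T>"
    and channel_support: "set_pmf \<psi> \<subseteq> \<T>"
    and finite_services: "t \<in> \<T> \<Longrightarrow> finite (S t)"
    and services_nonempty: "t \<in> \<T> \<Longrightarrow> S t \<noteq> {}"
    and services_nonneg: "t \<in> \<T> \<Longrightarrow> x \<in> S t \<Longrightarrow> 0 \<le> x"
    and services_maximal: "t \<in> \<T> \<Longrightarrow> S t = {coord_proj J v | J v. v \<in> maximal_vectors (S t)}"

definition capacity_region :: "'t set \<Rightarrow> ('t \<Rightarrow> (real ^ 'n) set) \<Rightarrow> 't pmf \<Rightarrow> (real ^ 'n) set" where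
  "capacity_region \<T> S \<psi> =
     {\<Sum>t\<in>\<T>. pmf \<psi> t *\<^sub>R x t | x. \<forall>t\<in>\<T>. x t \<in> convex hull (S t)}"

definition halfspace_description ::
    "(real ^ 'n) set \<Rightarrow> nat \<Rightarrow> (nat \<Rightarrow> real ^ 'n) \<Rightarrow> (nat \<Rightarrow> real) \<Rightarrow> bool" where
  "halfspace_description C L c b \<longleftrightarrow>
     (\<forall>l\<in>{1..L}. 0 \<le> c l \<and> norm (c l) = 1 \<and> 0 < b l) \<and>
     C = {x. 0 \<le> x \<and> (\<forall>l\<in>{1..L}. c l \<bullet> x \<le> b l)}"

definition minimal_halfspace_description ::
    "(real ^ 'n) set \<Rightarrow> nat \<Rightarrow> (nat \<Rightarrow> real ^ 'n) \<Rightarrow> (nat \<Rightarrow> real) \<Rightarrow> bool" where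
  "minimal_halfspace_description C L c b \<longleftrightarrow>
     halfspace_description C L c b \<and>
     (\<forall>L' c' b'. halfspace_description C L' c' b' \<longrightarrow> L \<le> L')"

definition facet :: "(real ^ 'n) set \<Rightarrow> real ^ 'n \<Rightarrow> real \<Rightarrow> (real ^ 'n) set" where
  "facet C c b = {x \<in> C. c \<bullet> x = b}"

definition max_service :: "('t \<Rightarrow> (real ^ 'n) set) \<Rightarrow> real ^ 'n \<Rightarrow> 't \<Rightarrow> real" where
  "max_service S c t = Max ((\<lambda>s. c \<bullet> s) ` S t)"

definition max_service_variance :: "('t \<Rightarrow> (real ^ 'n) set) \<Rightarrow> 't pmf \<Rightarrow> real ^ 'n \<Rightarrow> real" where
  "max_service_variance S \<psi> c =
     measure_pmf.variance (map_pmf (max_service S c) \<psi>) (\<lambda>x. x)"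


section \<open>The generalized switch under MaxWeight\<close>

definition queue_step :: "real ^ 'n \<Rightarrow> real ^ 'n \<Rightarrow> real ^ 'n \<Rightarrow> real ^ 'n" where
  "queue_step x \<alpha> s = (\<chi> i. max (x $ i + \<alpha> $ i - s $ i) 0)"

text \<open>The randomness of the switch: the initial queue lengths and, for every slot, the arrivals,
  the channel state and the randomness used to break ties. The families of \<open>indep_vars\<close> have a
  single range type, so mutual independence is stated for the generated \<open>\<sigma>\<close>-algebras.\<close>

datatype source = Initial | Arrival nat | Channel nat | Tie nat

text \<open>Random tie breaking: \<open>rule t x u\<close> is the MaxWeight service in channel state \<open>t\<close> at queue
  lengths \<open>x\<close>, where \<open>u\<close> is the value of a random variable that is drawn afresh in every slot. Every
  distribution on the maximizers, in particular the uniform one, has this form. Slots are numbered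
  from \<open>1\<close>; the values of the processes at \<open>0\<close> play no role.\<close>

locale maxweight_switch = prob_space M + service_structure \<T> S \<psi>
  for M :: "'w measure"
    and \<T> :: "'t set"
    and S :: "'t \<Rightarrow> (real ^ 'n) set"
    and \<psi> :: "'t pmf" +
  fixes A_max :: real
    and a :: "nat \<Rightarrow> 'w \<Rightarrow> real ^ 'n"
    and T :: "nat \<Rightarrow> 'w \<Rightarrow> 't"
    and U :: "nat \<Rightarrow> 'w \<Rightarrow> real"
    and rule :: "'t \<Rightarrow> real ^ 'n \<Rightarrow> real \<Rightarrow> real ^ 'n"
    and s :: "nat \<Rightarrow> 'w \<Rightarrow> real ^ 'n"
    and q :: "nat \<Rightarrow> 'w \<Rightarrow> real ^ 'n"
  assumes initial_measurable: "q 1 \<in> borel_measurable M"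
    and arrival_measurable: "1 \<le> k \<Longrightarrow> a k \<in> borel_measurable M"
    and channel_measurable: "1 \<le> k \<Longrightarrow> T k \<in> M \<rightarrow>\<^sub>M count_space \<T>"
    and tie_measurable: "1 \<le> k \<Longrightarrow> U k \<in> borel_measurable M"
    and rule_measurable: "t \<in> \<T> \<Longrightarrow> (\<lambda>(x, u). rule t x u) \<in> borel_measurable (borel \<Otimes>\<^sub>M borel)"
    and independent:
      "indep_sets
         (\<lambda>j. sets (case j of
             Initial \<Rightarrow> vimage_algebra (space M) (q 1) borel
           | Arrival k \<Rightarrow> vimage_algebra (space M) (a k) borel
           | Channel k \<Rightarrow> vimage_algebra (space M) (T k) (count_space \<T>)
           | Tie k \<Rightarrow> vimage_algebra (space M) (U k) borel))
         ({Initial} \<union> Arrival ` {1..} \<union> Channel ` {1..} \<union> Tie ` {1..})"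
    and arrival_identical: "1 \<le> k \<Longrightarrow> distr M borel (a k) = distr M borel (a 1)"
    and channel_law: "1 \<le> k \<Longrightarrow> t \<in> \<T> \<Longrightarrow> prob {\<omega> \<in> space M. T k \<omega> = t} = pmf \<psi> t"
    and tie_identical: "1 \<le> k \<Longrightarrow> distr M borel (U k) = distr M borel (U 1)"
    and arrival_range: "1 \<le> k \<Longrightarrow> \<omega> \<in> space M \<Longrightarrow> a k \<omega> $ i \<in> \<nat> \<and> a k \<omega> $ i \<le> A_max"
    and initial_nonneg: "\<omega> \<in> space M \<Longrightarrow> 0 \<le> q 1 \<omega>"
    and maxweight: "t \<in> \<T> \<Longrightarrow> is_arg_max (\<lambda>x. x \<bullet> y) (\<lambda>x. x \<in> S t) (rule t y u)"
    and service: "1 \<le> k \<Longrightarrow> \<omega> \<in> space M \<Longrightarrow> s k \<omega> = rule (T k \<omega>) (q k \<omega>) (U k \<omega>)"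
    and dynamics: "1 \<le> k \<Longrightarrow> \<omega> \<in> space M \<Longrightarrow> q (Suc k) \<omega> = queue_step (q k \<omega>) (a k \<omega>) (s k \<omega>)"

text \<open>A law \<open>\<mu>\<close> of the queue lengths is a steady state if one slot, whose arrivals, channel state
  and tie breaking are independent of the queue lengths, leaves it unchanged.\<close>

definition steady_state_law ::
    "'w measure \<Rightarrow> 't set \<Rightarrow> (nat \<Rightarrow> 'w \<Rightarrow> real ^ 'n) \<Rightarrow> (nat \<Rightarrow> 'w \<Rightarrow> 't) \<Rightarrow> (nat \<Rightarrow> 'w \<Rightarrow> real) \<Rightarrow>
     ('t \<Rightarrow> real ^ 'n \<Rightarrow> real \<Rightarrow> real ^ 'n) \<Rightarrow> (real ^ 'n) measure \<Rightarrow> bool" where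
  "steady_state_law M \<T> a T U rule \<mu> \<longleftrightarrow>
     distr (\<mu> \<Otimes>\<^sub>M distr M (borel \<Otimes>\<^sub>M count_space \<T> \<Otimes>\<^sub>M borel) (\<lambda>\<omega>. (a 1 \<omega>, T 1 \<omega>, U 1 \<omega>))) borel
       (\<lambda>(x, \<alpha>, t, u). queue_step x \<alpha> (rule t x u)) = \<mu>"

end

theory Submission
  imports Defs "HOL-Real_Asymp.Real_Asymp"
begin

text \<open>Write \<open>c\<close> for the normal of the facet, \<open>P x\<close> for the component of \<open>x\<close> orthogonal to \<open>c\<close> and
  \<open>q\<^sup>+\<close> for the queue lengths one slot after the stationary queue lengths \<open>q\<close>. The proof looks
  at a single slot, and the characteristic function of \<open>\<epsilon> * (c \<bullet> q)\<close> is all that has to be computed.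

  Geometry. In a minimal description every halfspace is irredundant, so the facet has full dimension
  in its hyperplane and \<open>r + v\<close> stays in the capacity region for all short \<open>v\<close> orthogonal to \<open>c\<close>
  (\<open>facet_interior_point\<close>). MaxWeight maximizes \<open>q \<bullet> x\<close> over the capacity region in the mean, hence
  it gains at least \<open>\<delta> * norm (P q)\<close> over the service \<open>r\<close>.

  Collapse. The drift of \<open>(norm q)\<^sup>2\<close> is therefore at most
  \<open>- 2 * \<epsilon> * (c \<bullet> q) - 2 * \<delta> * norm (P q)\<close> plus a constant, and that of \<open>(norm (P q))\<^sup>4\<close> is at most
  \<open>- (norm (P q))\<^sup>2\<close> plus a constant. Stationarity turns drift into moments
  (\<open>stationary_drift\<close>): \<open>\<epsilon> * E (c \<bullet> q)\<close> and \<open>E (norm (P q))\<^sup>2\<close> stay bounded as \<open>\<epsilon>\<close> goes to \<open>0\<close>.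

  Transform. Let \<open>B\<close> be the largest service in direction \<open>c\<close> in the present channel state. Then
  \<open>c \<bullet> q\<^sup>+ = c \<bullet> q + Z + Y + W\<close>, where \<open>Z = c \<bullet> a - B\<close> is independent of \<open>q\<close> and has mean
  \<open>- \<epsilon>\<close>, \<open>Y \<ge> 0\<close> is what MaxWeight falls short of \<open>B\<close>, and \<open>W \<ge> 0\<close> is the unused service in
  direction \<open>c\<close>.
  Stationarity of \<open>c \<bullet> q\<close> gives \<open>E (W + Y) = \<epsilon>\<close>. Unused service occurs only in empty queues and
  \<open>Y > 0\<close> only if \<open>norm (P q)\<close> is at least a fixed multiple of \<open>c \<bullet> q\<close>; thus \<open>(c \<bullet> q\<^sup>+) * W\<close> and \<open>(c \<bullet> q) * Y\<close> are bounded
  by multiples of \<open>W * norm (P q\<^sup>+)\<close> and \<open>Y * norm (P q)\<close>, whose means vanish with \<open>\<epsilon>\<close> by the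
  second moment of \<open>P q\<close>. Hence \<open>W\<close> and \<open>Y\<close> act as a reflection at \<open>0\<close>: with
  \<open>h = \<epsilon> * \<theta>\<close> and \<open>\<phi>(h) = E exp(i h (c \<bullet> q))\<close>, equating the transforms of \<open>c \<bullet> q\<^sup>+\<close> and \<open>c \<bullet> q\<close>
  yields \<open>\<phi>(h) = \<phi>(h) * (1 - i h \<epsilon> - h\<^sup>2 E Z\<^sup>2 / 2) + i h \<epsilon> + o(\<epsilon>\<^sup>2)\<close>
  (\<open>transform_estimate\<close>). Dividing by \<open>\<epsilon>\<^sup>2\<close> identifies the limit of \<open>\<phi>(\<epsilon> * \<theta>)\<close> as
  \<open>1 / (1 - i \<theta> m)\<close>, where \<open>2 * m\<close> is the limit of \<open>E Z\<^sup>2\<close>. That is the characteristic function of the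
  exponential law of mean \<open>m\<close>, so Levy's theorem applies to \<open>\<epsilon> * (c \<bullet> q)\<close>, and the bounded moments of
  \<open>P q\<close> carry the convergence over to \<open>\<epsilon> *\<^sub>R q\<close> (\<open>collapse_onto_line\<close>).\<close>

section \<open>Components along and across a direction\<close>

definition perp :: "'a::real_inner \<Rightarrow> 'a \<Rightarrow> 'a" where
  "perp c x = x - (c \<bullet> x) *\<^sub>R c"

lemma perp_add: "perp c (x + y) = perp c x + perp c y"
  by (simp add: perp_def algebra_simps)

lemma inner_perp_self: "norm c = 1 \<Longrightarrow> c \<bullet> perp c x = 0"
  by (simp add: perp_def inner_diff_right dot_square_norm)

lemma inner_perp: "perp c x \<bullet> y = x \<bullet> y - (c \<bullet> x) * (c \<bullet> y)"
  by (simp add: perp_def inner_diff_left)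

lemma perp_inner_perp: "norm c = 1 \<Longrightarrow> perp c x \<bullet> perp c y = perp c x \<bullet> y"
  by (simp add: perp_def inner_diff_left inner_diff_right dot_square_norm inner_commute algebra_simps)

lemma norm_perp_le: "norm c = 1 \<Longrightarrow> norm (perp c x) \<le> norm x"
proof -
  assume c: "norm c = 1"
  have "(norm (perp c x))\<^sup>2 = (norm x)\<^sup>2 - (c \<bullet> x)\<^sup>2"
  proof -
    have "c \<bullet> c = 1" using c by (simp add: dot_square_norm)
    then show ?thesis
      by (simp add: power2_norm_eq_inner perp_def inner_diff_left inner_diff_right inner_commute[of x c])
        (simp add: power2_eq_square)
  qed
  then have "(norm (perp c x))\<^sup>2 \<le> (norm x)\<^sup>2" by simp
  then show ?thesis by (rule power2_le_imp_le) simp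
qed

lemma measurable_perp [measurable]: "perp (c :: 'a :: {real_inner, second_countable_topology}) \<in> borel_measurable borel"
  unfolding perp_def[abs_def] by measurable

lemma inner_nonneg_vec: "0 \<le> x \<Longrightarrow> 0 \<le> y \<Longrightarrow> 0 \<le> x \<bullet> (y :: real ^ 'n)"
  by (simp add: inner_vec_def less_eq_vec_def sum_nonneg)

lemma norm_mono_vec: "0 \<le> x \<Longrightarrow> x \<le> y \<Longrightarrow> norm x \<le> norm (y :: real ^ 'n)"
  by (rule norm_le_componentwise_cart) (auto simp: less_eq_vec_def intro: order_trans)

lemma inner_nonneg_le_norm: "norm c = 1 \<Longrightarrow> c \<bullet> x \<le> norm x"
  using norm_cauchy_schwarz[of c x] by simp

section \<open>One slot of the queue dynamics\<close>

definition unused :: "real ^ 'n \<Rightarrow> real ^ 'n \<Rightarrow> real ^ 'n \<Rightarrow> real ^ 'n" where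
  "unused x \<alpha> s = queue_step x \<alpha> s - (x + \<alpha> - s)"

lemma queue_step_nonneg: "0 \<le> queue_step x \<alpha> s"
  by (simp add: queue_step_def less_eq_vec_def)

lemma unused_nonneg: "0 \<le> unused x \<alpha> s"
  by (simp add: unused_def queue_step_def less_eq_vec_def)

text \<open>The cut-off at \<open>0\<close> lifts a component from no less than minus the offered service.\<close>
lemma unused_le: "0 \<le> x \<Longrightarrow> 0 \<le> \<alpha> \<Longrightarrow> 0 \<le> s \<Longrightarrow> unused x \<alpha> s \<le> s"
  by (auto simp: unused_def queue_step_def less_eq_vec_def max_def) (smt (verit))

lemma unused_queue_step: "unused x \<alpha> s $ i * queue_step x \<alpha> s $ i = 0"
  by (simp add: unused_def queue_step_def max_def)

lemma unused_inner_queue_step: "unused x \<alpha> s \<bullet> queue_step x \<alpha> s = 0"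
  by (simp only: inner_vec_def inner_real_def unused_queue_step sum.neutral_const)

lemma queue_step_eq: "queue_step x \<alpha> s = x + (\<alpha> - s + unused x \<alpha> s)"
  by (simp add: unused_def)

lemma norm_queue_step_le: "norm (queue_step x \<alpha> s) \<le> norm (x + \<alpha> - s)"
  by (rule norm_le_componentwise_cart) (simp add: queue_step_def)

lemma queue_step_measurable [measurable]:
  "(\<lambda>z. queue_step (f z) (g z) (h z) :: real ^ 'n) \<in> borel_measurable N"
  if [measurable]: "f \<in> borel_measurable N" "g \<in> borel_measurable N" "h \<in> borel_measurable N"
proof -
  have "continuous_on UNIV (\<lambda>(x, \<alpha>, s). queue_step x \<alpha> s :: real ^ 'n)"
    unfolding queue_step_def case_prod_beta by (intro continuous_intros)
  from borel_measurable_continuous_onI[OF this]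
  have [measurable]: "(\<lambda>(x, \<alpha>, s). queue_step x \<alpha> s :: real ^ 'n) \<in> borel_measurable borel" .
  have "(\<lambda>z. (\<lambda>(x, \<alpha>, s). queue_step x \<alpha> s :: real ^ 'n) (f z, g z, h z)) \<in> borel_measurable N"
    by measurable
  then show ?thesis by simp
qed

locale slot_bounds =
  fixes x \<alpha> s c :: "real ^ 'n" and K :: real
  assumes x: "0 \<le> x" and \<alpha>: "0 \<le> \<alpha>" and s: "0 \<le> s"
    and \<alpha>K: "norm \<alpha> \<le> K" and sK: "norm s \<le> K"
    and c0: "0 \<le> c" and c1: "norm c = 1"
begin

abbreviation "y \<equiv> queue_step x \<alpha> s"
abbreviation "u \<equiv> unused x \<alpha> s"

lemma K0: "0 \<le> K" using sK norm_ge_zero order_trans by blast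

lemma norm_u: "norm u \<le> K"
  using norm_mono_vec[OF unused_nonneg unused_le[OF x \<alpha> s]] sK by linarith

lemma norm_increment: "norm (\<alpha> - s + u) \<le> 3 * K"
  using norm_triangle_ineq[of "\<alpha> - s" u] norm_triangle_ineq4[of \<alpha> s] \<alpha>K sK norm_u by linarith

text \<open>Cutting off at \<open>0\<close> moves every component towards \<open>0\<close>, so the unused service can be dropped.\<close>
lemma norm_square_step: "(norm y)\<^sup>2 \<le> (norm x)\<^sup>2 + 2 * (x \<bullet> (\<alpha> - s)) + 4 * K\<^sup>2"
proof -
  have "(norm y)\<^sup>2 \<le> (norm (x + (\<alpha> - s)))\<^sup>2"
    using norm_queue_step_le[of x \<alpha> s] by (intro power_mono) (simp_all add: add_diff_eq)
  also have "\<dots> = (norm x)\<^sup>2 + 2 * (x \<bullet> (\<alpha> - s)) + (norm (\<alpha> - s))\<^sup>2"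
    by (simp add: power2_norm_eq_inner inner_add_left inner_add_right inner_commute)
  also have "(norm (\<alpha> - s))\<^sup>2 \<le> (2 * K)\<^sup>2"
    using norm_triangle_ineq4[of \<alpha> s] \<alpha>K sK by (intro power_mono) auto
  finally show ?thesis by (simp add: power_mult_distrib)
qed

text \<open>A queue with unused service is empty after the slot, hence it held at most the offered service.\<close>
lemma x_inner_u: "x \<bullet> u \<le> K\<^sup>2"
proof -
  have "x = y - \<alpha> + s - u" by (simp add: unused_def)
  then have "x \<bullet> u = y \<bullet> u - \<alpha> \<bullet> u + s \<bullet> u - u \<bullet> u"
    by (metis inner_add_left inner_diff_left)
  also have "\<dots> \<le> s \<bullet> u"
    using unused_inner_queue_step[of x \<alpha> s] inner_nonneg_vec[OF \<alpha> unused_nonneg, of x \<alpha> s]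
      inner_ge_zero[of u] by (simp only: inner_commute[of y u])
  also have "\<dots> \<le> norm s * norm u" by (rule norm_cauchy_schwarz)
  also have "\<dots> \<le> K * K" using sK norm_u K0 by (intro mult_mono) auto
  finally show ?thesis by (simp add: power2_eq_square)
qed

text \<open>The unused service enters through \<open>x \<bullet> u - (c \<bullet> x) * (c \<bullet> u)\<close>. The first term is bounded although
  \<open>x\<close> is not, and the second one has a favourable sign.\<close>
lemma perp_square_step:
  "(norm (perp c y))\<^sup>2 \<le> (norm (perp c x))\<^sup>2 + 2 * (perp c x \<bullet> (\<alpha> - s)) + 11 * K\<^sup>2"
proof -
  let ?d = "\<alpha> - s + u"
  have "(norm (perp c y))\<^sup>2 = (norm (perp c x + perp c ?d))\<^sup>2"
    by (simp only: queue_step_eq perp_add)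
  also have "\<dots> = (norm (perp c x))\<^sup>2 + 2 * (perp c x \<bullet> perp c ?d) + (norm (perp c ?d))\<^sup>2"
    by (simp add: power2_norm_eq_inner inner_add_left inner_add_right inner_commute)
  also have "perp c x \<bullet> perp c ?d = perp c x \<bullet> (\<alpha> - s) + (x \<bullet> u - (c \<bullet> x) * (c \<bullet> u))"
    unfolding perp_inner_perp[OF c1] by (simp add: inner_add_right inner_perp)
  also have "(norm (perp c ?d))\<^sup>2 \<le> (3 * K)\<^sup>2"
    using norm_perp_le[OF c1, of ?d] norm_increment by (intro power_mono) auto
  also have "x \<bullet> u - (c \<bullet> x) * (c \<bullet> u) \<le> K\<^sup>2"
    using x_inner_u inner_nonneg_vec[OF c0 x] inner_nonneg_vec[OF c0 unused_nonneg, of x \<alpha> s]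
    by (meson diff_le_eq le_add_same_cancel1 mult_nonneg_nonneg order_trans)
  finally show ?thesis by (simp add: power_mult_distrib)
qed

text \<open>With \<open>D = P\<^sup>2 - p\<^sup>2\<close> the fourth power is \<open>P\<^sup>4 = p\<^sup>4 + 2 * p\<^sup>2 * D + D\<^sup>2\<close>, and \<open>D\<close> is at most
  linear in \<open>p\<close> because one slot moves the orthogonal component by at most \<open>3 * K\<close>. With the mean of
  \<open>perp c x \<bullet> (\<alpha> - s)\<close> at most \<open>- \<delta> * p\<close>, the drift is of order \<open>- p\<^sup>3\<close>, which is more than is
  necessary to control the second moment of \<open>p\<close>.\<close>
lemma perp_fourth_step:
  defines "p \<equiv> norm (perp c x)"
  shows "(norm (perp c y))^4 \<le> p^4 + 4 * p\<^sup>2 * (perp c x \<bullet> (\<alpha> - s)) + 94 * K\<^sup>2 * p\<^sup>2 + 162 * K^4"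
proof -
  define P where "P = norm (perp c y)"
  define D where "D = P\<^sup>2 - p\<^sup>2"
  have "perp c y = perp c x + perp c (\<alpha> - s + u)" by (simp only: queue_step_eq perp_add)
  then have *: "\<bar>P - p\<bar> \<le> 3 * K"
    using norm_perp_le[OF c1, of "\<alpha> - s + u"] norm_increment
      norm_triangle_ineq3[of "perp c y" "perp c x"] by (simp add: P_def p_def)
  have p0: "0 \<le> p" "0 \<le> P" by (auto simp: p_def P_def)
  have "\<bar>D\<bar> = \<bar>P - p\<bar> * (P + p)"
    using p0 unfolding D_def power2_eq_square square_diff_square_factored abs_mult by simp
  also have "\<dots> \<le> (3 * K) * (2 * p + 3 * K)"
    using * p0 K0 by (intro mult_mono) auto
  finally have "D\<^sup>2 \<le> ((3 * K) * (2 * p + 3 * K))\<^sup>2"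
    by (metis abs_ge_zero power2_abs power_mono)
  also have "\<dots> \<le> 72 * K\<^sup>2 * p\<^sup>2 + 162 * K^4"
  proof -
    have "(2 * p + 3 * K)\<^sup>2 \<le> 8 * p\<^sup>2 + 18 * K\<^sup>2"
      using sum_squares_ge_zero[of "2 * p - 3 * K" 0] by (simp add: power2_eq_square algebra_simps)
    then have "9 * K\<^sup>2 * (2 * p + 3 * K)\<^sup>2 \<le> 9 * K\<^sup>2 * (8 * p\<^sup>2 + 18 * K\<^sup>2)"
      by (intro mult_left_mono) auto
    moreover have "((3 * K) * (2 * p + 3 * K))\<^sup>2 = 9 * K\<^sup>2 * (2 * p + 3 * K)\<^sup>2"
      unfolding power_mult_distrib by simp
    ultimately show ?thesis by (simp add: algebra_simps flip: power_add)
  qed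
  finally have D2: "D\<^sup>2 \<le> 72 * K\<^sup>2 * p\<^sup>2 + 162 * K^4" .
  have "D \<le> 2 * (perp c x \<bullet> (\<alpha> - s)) + 11 * K\<^sup>2"
    using perp_square_step unfolding D_def P_def p_def by linarith
  then have "2 * p\<^sup>2 * D \<le> 2 * p\<^sup>2 * (2 * (perp c x \<bullet> (\<alpha> - s)) + 11 * K\<^sup>2)"
    by (intro mult_left_mono) auto
  moreover have "P^4 = p^4 + 2 * p\<^sup>2 * D + D\<^sup>2"
    unfolding D_def by (simp add: power2_eq_square power4_eq_xxxx algebra_simps)
  ultimately show ?thesis using D2 unfolding P_def by (simp add: algebra_simps)
qed

text \<open>Where \<open>u\<close> is positive \<open>y\<close> vanishes, so there the component of \<open>y\<close> along \<open>c\<close> is cancelled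
  exactly by the orthogonal component: \<open>u $ i * c $ i * (c \<bullet> y) = - u $ i * perp c y $ i\<close>.\<close>
lemma unused_alignment:
  assumes \<kappa>: "\<And>i. c $ i = 0 \<or> 1 \<le> \<kappa> * c $ i"
  shows "(c \<bullet> y) * (c \<bullet> u) \<le> \<kappa> * (c \<bullet> u) * norm (perp c y)"
proof -
  have "(c $ i * u $ i) * (c \<bullet> y) \<le> (c $ i * u $ i) * (\<kappa> * norm (perp c y))" for i
  proof (cases "c $ i = 0")
    case False
    then have k: "1 \<le> \<kappa> * c $ i" using \<kappa> by auto
    have ui: "0 \<le> u $ i" using unused_nonneg[of x \<alpha> s] by (simp add: less_eq_vec_def)
    have "(c $ i * u $ i) * (c \<bullet> y) = - (u $ i * perp c y $ i)"
      using unused_queue_step[of x \<alpha> s i] by (simp add: perp_def algebra_simps)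
    also have "\<dots> \<le> u $ i * norm (perp c y)"
      using ui component_le_norm_cart[of "perp c y" i]
      by (metis abs_le_D2 mult_left_mono mult_minus_right)
    also have "\<dots> \<le> u $ i * ((\<kappa> * c $ i) * norm (perp c y))"
      using k ui by (intro mult_left_mono) (auto simp: mult_le_cancel_right1)
    finally show ?thesis by (simp add: mult_ac)
  qed simp
  then have "(\<Sum>i\<in>UNIV. (c $ i * u $ i) * (c \<bullet> y)) \<le> (\<Sum>i\<in>UNIV. (c $ i * u $ i) * (\<kappa> * norm (perp c y)))"
    by (intro sum_mono) auto
  then show ?thesis
    unfolding sum_distrib_right[symmetric] by (simp add: inner_vec_def mult_ac)
qed

end

section \<open>Moments of stationary laws from drift\<close>

text \<open>If \<open>V\<close> is integrable, stationarity makes its mean drift vanish and the bound is immediate. An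
  invariant law need not integrate \<open>V\<close>, so the argument is applied to \<open>min V n\<close>. Its mean drift
  vanishes, and by concavity its drift at \<open>x\<close> is at most \<open>min (V x - f x + k) n - min (V x) n\<close>. The
  difference between \<open>k\<close> and this bound is nonnegative and tends to \<open>f x\<close> as \<open>n\<close> grows, so Fatou's
  lemma bounds the integral of \<open>f\<close>.\<close>
lemma stationary_drift:
  fixes V f :: "'a \<Rightarrow> real"
  assumes "prob_space \<mu>" and "prob_space M"
    and G: "G \<in> \<mu> \<Otimes>\<^sub>M M \<rightarrow>\<^sub>M \<mu>"
    and stationary: "distr (\<mu> \<Otimes>\<^sub>M M) \<mu> G = \<mu>"
    and V: "V \<in> borel_measurable \<mu>" "\<And>x. 0 \<le> V x"
    and f: "f \<in> borel_measurable \<mu>"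
    and k: "0 \<le> k"
    and drift: "AE x in \<mu>. 0 \<le> f x \<and> integrable M (\<lambda>\<omega>. V (G (x, \<omega>))) \<and>
      (\<integral>\<omega>. V (G (x, \<omega>)) \<partial>M) \<le> V x - f x + k"
  shows "integrable \<mu> f" and "(\<integral>x. f x \<partial>\<mu>) \<le> k"
proof -
  interpret \<mu>: prob_space \<mu> by fact
  interpret M: prob_space M by fact
  interpret P: pair_prob_space \<mu> M ..
  note [measurable] = G V(1) f
  \<comment> \<open>The least possible mean decrease of \<open>min V n\<close> in one step, increased by \<open>k\<close> to make it nonnegative.\<close>
  define g where "g n x = k - (min (V x - f x + k) (real n) - min (V x) (real n))" for n x
  have [measurable]: "g n \<in> borel_measurable \<mu>" for n
    unfolding g_def by measurable
  have W0: "AE x in \<mu>. 0 \<le> V x - f x + k"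
    using drift
  proof eventually_elim
    case (elim x)
    have "0 \<le> (\<integral>\<omega>. V (G (x, \<omega>)) \<partial>M)" using V(2) by (intro integral_nonneg_AE) auto
    then show ?case using elim by linarith
  qed
  have k0: "AE x in \<mu>. \<forall>n. 0 \<le> g n x \<and> \<bar>min (V x - f x + k) (real n)\<bar> \<le> real n"
    using W0 drift
  proof eventually_elim
    case (elim x)
    then show ?case using V(2)[of x] k unfolding g_def by (auto simp: min_def)
  qed
  have mintV: "integrable \<mu> (\<lambda>x. min (V x) (real n))" for n
    using V(2) by (intro \<mu>.integrable_const_bound[of _ "real n"]) (auto simp: min_def)
  have mintW: "integrable \<mu> (\<lambda>x. min (V x - f x + k) (real n))" for n
    using k0 by (intro \<mu>.integrable_const_bound[of _ "real n"]) (auto elim!: eventually_mono)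
  have int_g: "integrable \<mu> (g n)" for n
    unfolding g_def using mintV mintW by auto
  have le: "(\<integral>x. g n x \<partial>\<mu>) \<le> k" for n
  proof -
    have intP: "integrable (\<mu> \<Otimes>\<^sub>M M) (\<lambda>z. min (V (G z)) (real n))"
      using V(2) by (intro P.P.integrable_const_bound[of _ "real n"]) (auto simp: min_def)
    have "(\<integral>x. min (V x) (real n) \<partial>\<mu>) = (\<integral>x. min (V x) (real n) \<partial>distr (\<mu> \<Otimes>\<^sub>M M) \<mu> G)"
      by (simp add: stationary)
    also have "\<dots> = (\<integral>z. min (V (G z)) (real n) \<partial>(\<mu> \<Otimes>\<^sub>M M))"
      by (subst integral_distr) auto
    also have "\<dots> = (\<integral>x. (\<integral>\<omega>. min (V (G (x, \<omega>))) (real n) \<partial>M) \<partial>\<mu>)"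
      by (rule P.integral_fst'[symmetric, OF intP])
    also have "\<dots> \<le> (\<integral>x. min (V x - f x + k) (real n) \<partial>\<mu>)"
    proof (rule integral_mono_AE)
      show "integrable \<mu> (\<lambda>x. \<integral>\<omega>. min (V (G (x, \<omega>))) (real n) \<partial>M)"
        by (rule P.integrable_fst'[OF intP])
      show "integrable \<mu> (\<lambda>x. min (V x - f x + k) (real n))" by (rule mintW)
      show "AE x in \<mu>. (\<integral>\<omega>. min (V (G (x, \<omega>))) (real n) \<partial>M) \<le> min (V x - f x + k) (real n)"
        using drift AE_space
      proof eventually_elim
        case (elim x)
        have [measurable]: "(\<lambda>\<omega>. G (x, \<omega>)) \<in> M \<rightarrow>\<^sub>M \<mu>" using elim(2) by simp
        have i: "integrable M (\<lambda>\<omega>. min (V (G (x, \<omega>))) (real n))"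
          using V(2) by (intro M.integrable_const_bound[of _ "real n"]) (auto simp: min_def)
        have "(\<integral>\<omega>. min (V (G (x, \<omega>))) (real n) \<partial>M) \<le> (\<integral>\<omega>. V (G (x, \<omega>)) \<partial>M)"
          using elim i by (intro integral_mono) auto
        moreover have "(\<integral>\<omega>. min (V (G (x, \<omega>))) (real n) \<partial>M) \<le> (\<integral>\<omega>. real n \<partial>M)"
          using i by (intro integral_mono) auto
        ultimately show ?case using elim M.prob_space by simp
      qed
    qed
    finally show ?thesis
      unfolding g_def using mintV[of n] mintW[of n] \<mu>.prob_space by simp
  qed
  have "(\<integral>\<^sup>+x. ennreal (f x) \<partial>\<mu>) \<le> (\<integral>\<^sup>+x. liminf (\<lambda>n. ennreal (g n x)) \<partial>\<mu>)"
  proof (rule nn_integral_mono)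
    fix x
    have "eventually (\<lambda>n. g n x = f x) sequentially"
      using eventually_ge_at_top[of "nat \<lceil>max (V x - f x + k) (V x)\<rceil>"]
    proof eventually_elim
      case (elim n)
      then have "max (V x - f x + k) (V x) \<le> real n" by linarith
      then show ?case unfolding g_def by (simp add: min_def)
    qed
    then have "(\<lambda>n. ennreal (g n x)) \<longlonglongrightarrow> ennreal (f x)"
      by (intro tendsto_eventually) (auto elim: eventually_mono)
    then show "ennreal (f x) \<le> liminf (\<lambda>n. ennreal (g n x))"
      by (simp add: lim_imp_Liminf)
  qed
  also have "\<dots> \<le> liminf (\<lambda>n. \<integral>\<^sup>+x. ennreal (g n x) \<partial>\<mu>)"
    by (rule nn_integral_liminf) auto
  also have "(\<lambda>n. \<integral>\<^sup>+x. ennreal (g n x) \<partial>\<mu>) = (\<lambda>n. ennreal (\<integral>x. g n x \<partial>\<mu>))"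
    using k0 by (intro ext nn_integral_eq_integral int_g) (auto elim: eventually_mono)
  also have "liminf \<dots> \<le> liminf (\<lambda>n::nat. ennreal k)"
    by (intro Liminf_mono always_eventually allI ennreal_leI le)
  finally have nn: "(\<integral>\<^sup>+x. ennreal (f x) \<partial>\<mu>) \<le> ennreal k"
    by (simp add: Liminf_const)
  show int: "integrable \<mu> f"
    using nn drift by (intro integrableI_nonneg) (auto elim: eventually_mono intro: le_less_trans)
  have "ennreal (\<integral>x. f x \<partial>\<mu>) \<le> ennreal k"
    using nn drift by (subst nn_integral_eq_integral[OF int, symmetric]) (auto elim: eventually_mono)
  then show "(\<integral>x. f x \<partial>\<mu>) \<le> k" using k by (simp add: ennreal_le_iff)
qed

section \<open>The oscillating exponential over one slot\<close>

lemma iexp_minus_one: "norm (iexp t - 1) \<le> \<bar>t\<bar>"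
  using iexp_approx1[of t 0] by simp

lemma iexp_linear: "norm (iexp t - 1 - \<i> * t) \<le> t\<^sup>2 / 2"
  using iexp_approx1[of t 1] by (simp add: diff_diff_eq numeral_2_eq_2 power2_eq_square)

lemma iexp_quadratic: "norm (iexp t - 1 - \<i> * t + t\<^sup>2 / 2) \<le> \<bar>t\<bar>^3 / 6"
  using iexp_approx1[of t 2]
  by (simp add: numeral_3_eq_3 numeral_2_eq_2 power2_eq_square algebra_simps fact_reduce) 

lemma iexp_add: "iexp (s + t) = iexp s * iexp t"
  by (simp add: exp_add algebra_simps)

lemma norm_iexp: "norm (iexp t) = 1"
  by (simp add: norm_exp_i_times)

text \<open>The losses \<open>Y\<close> and \<open>w\<close> contribute \<open>\<i> * h * (w + Y)\<close> as if they occurred at \<open>X = 0\<close> and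
  \<open>X' = 0\<close> only. The price for this is of second order in \<open>h\<close> and is weighted by \<open>X' * w\<close> and \<open>X * Y\<close>.
  Multiplying with \<open>iexp (- (h * w))\<close> moves \<open>w\<close> to the side of \<open>X'\<close>, which pairs it with \<open>X'\<close>
  rather than \<open>X\<close>.\<close>
lemma iexp_step_estimate:
  fixes X X' Z Y w h :: real
  assumes X': "X' = X + Z + Y + w" and nonneg: "0 \<le> X" "0 \<le> X'" "0 \<le> Y" "0 \<le> w"
  shows "norm (iexp (h * X') - iexp (h * X) * iexp (h * Z) - \<i> * (h * (w + Y)))
    \<le> h\<^sup>2 * (X' * w + w\<^sup>2 / 2 + X * Y + \<bar>Z\<bar> * Y + Y\<^sup>2 / 2)"
proof -
  have e1: "iexp (h * X') * iexp (- (h * w)) = iexp (h * X) * iexp (h * Z) * iexp (h * Y)"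
    unfolding iexp_add[symmetric] X' by (simp add: algebra_simps)
  define P1 where "P1 = (iexp (h * X') - 1) * (1 - iexp (- (h * w)))"
  define P2 where "P2 = iexp (- (h * w)) - 1 - \<i> * (- (h * w))"
  define P3 where "P3 = (iexp (h * X + h * Z) - 1) * (iexp (h * Y) - 1)"
  define P4 where "P4 = iexp (h * Y) - 1 - \<i> * (h * Y)"
  have "iexp (h * X') - iexp (h * X) * iexp (h * Z) - \<i> * (h * (w + Y)) = P1 - P2 + P3 + P4"
    unfolding P1_def P2_def P3_def P4_def iexp_add using e1 by (simp add: algebra_simps)
  then have "norm (iexp (h * X') - iexp (h * X) * iexp (h * Z) - \<i> * (h * (w + Y)))
    \<le> norm P1 + norm P2 + norm P3 + norm P4"
    by (metis (no_types, lifting) add_mono norm_triangle_ineq norm_triangle_ineq4 order_trans order_refl)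
  moreover have "norm P1 \<le> \<bar>h * X'\<bar> * \<bar>h * w\<bar>"
    unfolding P1_def norm_mult using iexp_minus_one[of "h * X'"] iexp_minus_one[of "- (h * w)"]
    by (intro mult_mono) (auto simp: norm_minus_commute)
  moreover have "norm P2 \<le> (h * w)\<^sup>2 / 2"
    unfolding P2_def using iexp_linear[of "- (h * w)"] by simp
  moreover have "norm P3 \<le> \<bar>h * X + h * Z\<bar> * \<bar>h * Y\<bar>"
    unfolding P3_def norm_mult using iexp_minus_one[of "h * X + h * Z"] iexp_minus_one[of "h * Y"]
    by (intro mult_mono) auto
  moreover have "norm P4 \<le> (h * Y)\<^sup>2 / 2"
    unfolding P4_def using iexp_linear[of "h * Y"] by simp
  moreover have "\<bar>h * X'\<bar> * \<bar>h * w\<bar> = h\<^sup>2 * (X' * w)"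
    using nonneg by (simp add: abs_mult power2_eq_square mult_ac)
  moreover have "\<bar>h * X + h * Z\<bar> * \<bar>h * Y\<bar> \<le> h\<^sup>2 * (X * Y + \<bar>Z\<bar> * Y)"
  proof -
    have "\<bar>h * X + h * Z\<bar> * \<bar>h * Y\<bar> = h\<^sup>2 * (\<bar>X + Z\<bar> * Y)"
      using nonneg unfolding distrib_left[symmetric] abs_mult by (simp add: power2_eq_square mult_ac)
    also have "\<dots> \<le> h\<^sup>2 * ((X + \<bar>Z\<bar>) * Y)"
      using nonneg by (intro mult_left_mono mult_right_mono) auto
    finally show ?thesis by (simp only: distrib_right)
  qed
  ultimately show ?thesis by (simp add: power_mult_distrib algebra_simps)
qed

section \<open>Stationary queues near a facet\<close>

text \<open>Bounds the second moment of the orthogonal component; no \<open>\<epsilon>\<close> occurs in it, which is the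
  state space collapse.\<close>
definition collapse_bound :: "real \<Rightarrow> real \<Rightarrow> real" where
  "collapse_bound \<delta> K = (94 * K\<^sup>2 + 1)^3 / (16 * \<delta>\<^sup>2) + 162 * K^4"

definition transform_error :: "real \<Rightarrow> real \<Rightarrow> real \<Rightarrow> real" where
  "transform_error \<delta> K \<kappa> = 2 * \<kappa> * collapse_bound \<delta> K + \<kappa> * K + 2 * K"

text \<open>A stationary law \<open>\<mu>\<close> of the queue lengths together with the randomness \<open>M\<close> of one slot. The
  assumption \<open>service_gain\<close> is what MaxWeight achieves in the mean near an interior point of a facet
  with normal \<open>c\<close>. The assumption \<open>alignment\<close> says that a service that falls short of the best one
  in direction \<open>c\<close> is chosen only at queue lengths whose orthogonal component is at least a fixed
  multiple of the component along \<open>c\<close>. The constants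
  \<open>\<delta>\<close>, \<open>K\<close> and \<open>\<kappa>\<close> are common to the whole family of switches.\<close>
locale heavy_traffic_slot = pair_prob_space \<mu> M
  for \<mu> :: "(real ^ 'n) measure" and M :: "'w measure" +
  fixes A :: "'w \<Rightarrow> real ^ 'n" and srv :: "real ^ 'n \<Rightarrow> 'w \<Rightarrow> real ^ 'n" and B :: "'w \<Rightarrow> real"
    and c r :: "real ^ 'n" and \<epsilon> \<delta> K \<kappa> :: real
  assumes sets_mu [simp, measurable_cong]: "sets \<mu> = sets borel"
    and A_measurable [measurable]: "A \<in> borel_measurable M"
    and srv_measurable [measurable]: "(\<lambda>(x, \<omega>). srv x \<omega>) \<in> borel_measurable (borel \<Otimes>\<^sub>M M)"
    and B_measurable [measurable]: "B \<in> borel_measurable M"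
    and A_nonneg: "\<omega> \<in> space M \<Longrightarrow> 0 \<le> A \<omega>" and A_bound: "\<omega> \<in> space M \<Longrightarrow> norm (A \<omega>) \<le> K"
    and srv_nonneg: "\<omega> \<in> space M \<Longrightarrow> 0 \<le> srv x \<omega>"
    and srv_bound: "\<omega> \<in> space M \<Longrightarrow> norm (srv x \<omega>) \<le> K"
    and srv_le_B: "\<omega> \<in> space M \<Longrightarrow> c \<bullet> srv x \<omega> \<le> B \<omega>" and B_bound: "\<omega> \<in> space M \<Longrightarrow> B \<omega> \<le> K"
    and mean_A: "(\<integral>\<omega>. A \<omega> \<partial>M) = r - \<epsilon> *\<^sub>R c" and mean_B: "(\<integral>\<omega>. B \<omega> \<partial>M) = c \<bullet> r"
    and c_nonneg: "0 \<le> c" and norm_c: "norm c = 1"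
    and \<epsilon>: "0 < \<epsilon>" "\<epsilon> < 1" and \<delta>: "0 < \<delta>" and \<kappa>: "0 \<le> \<kappa>"
    and service_gain: "0 \<le> x \<Longrightarrow> x \<bullet> r + \<delta> * norm (perp c x) \<le> (\<integral>\<omega>. x \<bullet> srv x \<omega> \<partial>M)"
    and alignment: "0 \<le> x \<Longrightarrow> \<omega> \<in> space M \<Longrightarrow>
      (c \<bullet> x) * (B \<omega> - c \<bullet> srv x \<omega>) \<le> \<kappa> * (B \<omega> - c \<bullet> srv x \<omega>) * norm (perp c x)"
    and \<kappa>_c: "c $ i = 0 \<or> 1 \<le> \<kappa> * c $ i"
    and stationary: "distr (\<mu> \<Otimes>\<^sub>M M) borel (\<lambda>(x, \<omega>). queue_step x (A \<omega>) (srv x \<omega>)) = \<mu>"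
begin

abbreviation "Q \<equiv> \<mu> \<Otimes>\<^sub>M M"

abbreviation "D \<equiv> collapse_bound \<delta> K"

definition next_queue :: "(real ^ 'n) \<times> 'w \<Rightarrow> real ^ 'n" where
  "next_queue z = queue_step (fst z) (A (snd z)) (srv (fst z) (snd z))"

lemma space_mu [simp]: "space \<mu> = UNIV"
  using sets_eq_imp_space_eq[OF sets_mu] by simp

lemma srv_measurable' [measurable]:
  "(\<lambda>z. srv (f z) (g z)) \<in> borel_measurable N"
  if [measurable]: "f \<in> borel_measurable N" "g \<in> N \<rightarrow>\<^sub>M M"
proof -
  have "(\<lambda>z. (\<lambda>(x, \<omega>). srv x \<omega>) (f z, g z)) \<in> borel_measurable N" by measurable
  then show ?thesis by simp
qed

lemma next_queue_measurable [measurable]: "next_queue \<in> borel_measurable Q"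
  unfolding next_queue_def by measurable

lemma distr_next_queue: "distr Q \<mu> next_queue = \<mu>"
proof -
  have "distr Q \<mu> next_queue = distr Q borel (\<lambda>(x, \<omega>). queue_step x (A \<omega>) (srv x \<omega>))"
    by (rule distr_cong) (auto simp: next_queue_def)
  then show ?thesis using stationary by simp
qed

lemma distr_fst: "distr Q \<mu> fst = \<mu>"
proof (rule measure_eqI)
  fix X assume "X \<in> sets (distr Q \<mu> fst)"
  then have X: "X \<in> sets \<mu>" by simp
  have "fst -` X \<inter> space Q = X \<times> space M"
    using sets.sets_into_space[OF X] by (auto simp: space_pair_measure)
  then show "emeasure (distr Q \<mu> fst) X = emeasure \<mu> X"
    using X by (simp add: emeasure_distr M2.emeasure_pair_measure_Times M2.emeasure_space_1)
qed simp

lemma distr_snd: "distr Q M snd = M"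
proof (rule measure_eqI)
  fix X assume "X \<in> sets (distr Q M snd)"
  then have X: "X \<in> sets M" by simp
  have "snd -` X \<inter> space Q = space \<mu> \<times> X"
    using sets.sets_into_space[OF X] by (auto simp: space_pair_measure)
  then show "emeasure (distr Q M snd) X = emeasure M X"
    using X M1.emeasure_space_1 by (simp add: emeasure_distr M2.emeasure_pair_measure_Times)
qed simp

lemma integral_next_queue:
  fixes f :: "real ^ 'n \<Rightarrow> 'b::{banach, second_countable_topology}"
  assumes [measurable]: "f \<in> borel_measurable borel"
  shows "(\<integral>z. f (next_queue z) \<partial>Q) = (\<integral>x. f x \<partial>\<mu>)" and "integrable Q (\<lambda>z. f (next_queue z)) \<longleftrightarrow> integrable \<mu> f"
  using integral_distr[of next_queue Q \<mu> f] integrable_distr_eq[of next_queue Q \<mu> f] by (simp_all add: distr_next_queue)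

lemma integral_queue:
  fixes f :: "real ^ 'n \<Rightarrow> 'b::{banach, second_countable_topology}"
  assumes [measurable]: "f \<in> borel_measurable borel"
  shows "(\<integral>z. f (fst z) \<partial>Q) = (\<integral>x. f x \<partial>\<mu>)" and "integrable Q (\<lambda>z. f (fst z)) \<longleftrightarrow> integrable \<mu> f"
  using integral_distr[of fst Q \<mu> f] integrable_distr_eq[of fst Q \<mu> f] by (simp_all add: distr_fst)

lemma integral_noise:
  fixes f :: "'w \<Rightarrow> 'b::{banach, second_countable_topology}"
  assumes [measurable]: "f \<in> borel_measurable M"
  shows "(\<integral>z. f (snd z) \<partial>Q) = (\<integral>\<omega>. f \<omega> \<partial>M)" and "integrable Q (\<lambda>z. f (snd z)) \<longleftrightarrow> integrable M f"
  using integral_distr[of snd Q M f] integrable_distr_eq[of snd Q M f] by (simp_all add: distr_snd)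

lemma nonneg_orthant_measurable [measurable]: "{x :: real ^ 'n. 0 \<le> x} \<in> sets borel"
proof -
  have "{x :: real ^ 'n. 0 \<le> x} = (\<Inter>i. {x. 0 \<le> x $ i})" by (auto simp: less_eq_vec_def)
  then show ?thesis by simp
qed

lemma AE_nonneg: "AE x in \<mu>. 0 \<le> x"
proof -
  have "AE x in distr Q \<mu> next_queue. 0 \<le> x"
    by (subst AE_distr_iff) (auto simp: next_queue_def queue_step_nonneg)
  then show ?thesis by (simp only: distr_next_queue)
qed

lemma AE_nonneg_slot: "AE z in Q. 0 \<le> fst z \<and> snd z \<in> space M"
proof -
  have "AE x in distr Q \<mu> fst. 0 \<le> x" using AE_nonneg by (simp only: distr_fst)
  then have "AE z in Q. 0 \<le> fst z"
    by (subst (asm) AE_distr_iff) auto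
  then show ?thesis using AE_space by eventually_elim (auto simp: space_pair_measure)
qed

lemma slot: "0 \<le> x \<Longrightarrow> \<omega> \<in> space M \<Longrightarrow> slot_bounds x (A \<omega>) (srv x \<omega>) c K"
  by unfold_locales (auto simp: A_nonneg A_bound srv_nonneg srv_bound c_nonneg norm_c)

lemma K_nonneg: "0 \<le> K"
proof -
  obtain \<omega> where "\<omega> \<in> space M" using M2.not_empty by auto
  then show ?thesis using A_bound[of \<omega>] norm_ge_zero[of "A \<omega>"] by linarith
qed

lemma integrable_A: "integrable M A"
  using A_bound by (intro M2.integrable_const_bound[of _ K]) auto

lemma integrable_srv: "integrable M (srv x)"
  using srv_bound by (intro M2.integrable_const_bound[of _ K]) auto

lemma B_nonneg: "\<omega> \<in> space M \<Longrightarrow> 0 \<le> B \<omega>"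
  using srv_le_B[of \<omega> 0] inner_nonneg_vec[OF c_nonneg srv_nonneg, of \<omega> 0] by linarith

lemma integrable_B: "integrable M B"
  using B_bound B_nonneg by (intro M2.integrable_const_bound[of _ K]) auto

lemma mean_drift:
  assumes "0 \<le> x"
  shows "(\<integral>\<omega>. x \<bullet> (A \<omega> - srv x \<omega>) \<partial>M) \<le> - \<epsilon> * (c \<bullet> x) - \<delta> * norm (perp c x)"
proof -
  have "(\<integral>\<omega>. x \<bullet> (A \<omega> - srv x \<omega>) \<partial>M) = x \<bullet> (r - \<epsilon> *\<^sub>R c) - (\<integral>\<omega>. x \<bullet> srv x \<omega> \<partial>M)"
    using integrable_A integrable_srv by (simp add: inner_diff_right mean_A)
  then show ?thesis using service_gain[OF assms] by (simp add: inner_diff_right inner_commute)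
qed

text \<open>Along \<open>c\<close> the arrivals fall short of the service by at most \<open>\<epsilon>\<close> in the mean. This cancels the
  term \<open>- \<epsilon> * (c \<bullet> x)\<close> of the total drift, and the part that is uniform in \<open>\<epsilon>\<close> remains.\<close>
lemma mean_perp_drift:
  assumes "0 \<le> x"
  shows "(\<integral>\<omega>. perp c x \<bullet> (A \<omega> - srv x \<omega>) \<partial>M) \<le> - \<delta> * norm (perp c x)"
proof -
  have i: "integrable M (\<lambda>\<omega>. A \<omega> - srv x \<omega>)" using integrable_A integrable_srv by auto
  have "(\<integral>\<omega>. c \<bullet> srv x \<omega> \<partial>M) \<le> (\<integral>\<omega>. B \<omega> \<partial>M)"
    using integrable_srv integrable_B srv_le_B by (intro integral_mono) auto
  then have "(\<integral>\<omega>. c \<bullet> srv x \<omega> \<partial>M) \<le> c \<bullet> r" by (simp add: mean_B)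
  moreover have "(\<integral>\<omega>. c \<bullet> (A \<omega> - srv x \<omega>) \<partial>M) = c \<bullet> (r - \<epsilon> *\<^sub>R c) - (\<integral>\<omega>. c \<bullet> srv x \<omega> \<partial>M)"
    using integrable_A integrable_srv by (simp add: inner_diff_right mean_A)
  ultimately have "- \<epsilon> \<le> (\<integral>\<omega>. c \<bullet> (A \<omega> - srv x \<omega>) \<partial>M)"
    by (simp add: inner_diff_right dot_square_norm norm_c)
  then have "(c \<bullet> x) * (- \<epsilon>) \<le> (c \<bullet> x) * (\<integral>\<omega>. c \<bullet> (A \<omega> - srv x \<omega>) \<partial>M)"
    using inner_nonneg_vec[OF c_nonneg assms] by (intro mult_left_mono)
  moreover have "(\<integral>\<omega>. perp c x \<bullet> (A \<omega> - srv x \<omega>) \<partial>M)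
    = (\<integral>\<omega>. x \<bullet> (A \<omega> - srv x \<omega>) \<partial>M) - (c \<bullet> x) * (\<integral>\<omega>. c \<bullet> (A \<omega> - srv x \<omega>) \<partial>M)"
    unfolding inner_perp using i
    by (subst Bochner_Integration.integral_diff) auto
  ultimately show ?thesis using mean_drift[OF assms] by (simp add: algebra_simps)
qed

lemma norm_next_queue_le: "0 \<le> x \<Longrightarrow> \<omega> \<in> space M \<Longrightarrow> norm (next_queue (x, \<omega>)) \<le> norm x + 3 * K"
proof -
  assume *: "0 \<le> x" "\<omega> \<in> space M"
  interpret slot_bounds x "A \<omega>" "srv x \<omega>" c K by (rule slot[OF *])
  show ?thesis
    using norm_triangle_ineq[of x "A \<omega> - srv x \<omega> + u"] norm_increment
    unfolding next_queue_def queue_step_eq by simp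
qed

text \<open>The drift of \<open>(norm x)\<^sup>2\<close> is linear in both components of \<open>x\<close>, with the weight \<open>\<epsilon>\<close> along \<open>c\<close> and
  the weight \<open>\<delta>\<close> across it; this already shows the two different scales.\<close>
lemma first_moments:
  shows integrable_workload: "integrable \<mu> (\<lambda>x. c \<bullet> x)"
    and integrable_perp: "integrable \<mu> (\<lambda>x. norm (perp c x))"
    and workload_bound: "\<epsilon> * (\<integral>x. c \<bullet> x \<partial>\<mu>) \<le> 2 * K\<^sup>2"
    and perp_bound: "\<delta> * (\<integral>x. norm (perp c x) \<partial>\<mu>) \<le> 2 * K\<^sup>2"
proof -
  let ?f = "\<lambda>x. 2 * \<epsilon> * (c \<bullet> x) + 2 * \<delta> * norm (perp c x)"
  have d: "AE x in \<mu>. 0 \<le> ?f x \<and> integrable M (\<lambda>\<omega>. (norm (next_queue (x, \<omega>)))\<^sup>2) \<and>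
      (\<integral>\<omega>. (norm (next_queue (x, \<omega>)))\<^sup>2 \<partial>M) \<le> (norm x)\<^sup>2 - ?f x + 4 * K\<^sup>2"
    using AE_nonneg
  proof eventually_elim
    case (elim x)
    have [measurable]: "(\<lambda>\<omega>. next_queue (x, \<omega>)) \<in> borel_measurable M" by simp
    have i: "integrable M (\<lambda>\<omega>. (norm (next_queue (x, \<omega>)))\<^sup>2)"
      using norm_next_queue_le[OF elim]
      by (intro M2.integrable_const_bound[of _ "(norm x + 3 * K)\<^sup>2"] AE_I2) (auto intro!: power_mono)
    have i': "integrable M (\<lambda>\<omega>. x \<bullet> (A \<omega> - srv x \<omega>))" using integrable_A integrable_srv by auto
    have "(\<integral>\<omega>. (norm (next_queue (x, \<omega>)))\<^sup>2 \<partial>M)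
      \<le> (\<integral>\<omega>. (norm x)\<^sup>2 + 2 * (x \<bullet> (A \<omega> - srv x \<omega>)) + 4 * K\<^sup>2 \<partial>M)"
      using i i' slot_bounds.norm_square_step[OF slot[OF elim]]
      by (intro integral_mono) (auto simp: next_queue_def)
    also have "\<dots> = (norm x)\<^sup>2 + 2 * (\<integral>\<omega>. x \<bullet> (A \<omega> - srv x \<omega>) \<partial>M) + 4 * K\<^sup>2"
      using i' M2.prob_space by simp
    finally show ?case
      using i mean_drift[OF elim] inner_nonneg_vec[OF c_nonneg elim] \<epsilon> \<delta> by (simp add: algebra_simps)
  qed
  have f: "integrable \<mu> ?f" "(\<integral>x. ?f x \<partial>\<mu>) \<le> 4 * K\<^sup>2"
    using stationary_drift[OF M1.prob_space_axioms M2.prob_space_axioms _ distr_next_queue _ _ _ _ d] by auto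
  show 1: "integrable \<mu> (\<lambda>x. c \<bullet> x)"
  proof (rule Bochner_Integration.integrable_bound[of _ "\<lambda>x. ?f x / (2 * \<epsilon>)"])
    show "AE x in \<mu>. norm (c \<bullet> x) \<le> norm (?f x / (2 * \<epsilon>))"
      using AE_nonneg
    proof eventually_elim
      case (elim x)
      then show ?case using inner_nonneg_vec[OF c_nonneg elim] \<epsilon> \<delta> by (simp add: field_simps)
    qed
  qed (use f in auto)
  show 2: "integrable \<mu> (\<lambda>x. norm (perp c x))"
  proof (rule Bochner_Integration.integrable_bound[of _ "\<lambda>x. ?f x / (2 * \<delta>)"])
    show "AE x in \<mu>. norm (norm (perp c x)) \<le> norm (?f x / (2 * \<delta>))"
      using AE_nonneg
    proof eventually_elim
      case (elim x)
      then show ?case using inner_nonneg_vec[OF c_nonneg elim] \<epsilon> \<delta> by (simp add: field_simps)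
    qed
  qed (use f in auto)
  have "0 \<le> (\<integral>x. c \<bullet> x \<partial>\<mu>)"
    using AE_nonneg inner_nonneg_vec[OF c_nonneg] by (intro integral_nonneg_AE) (auto elim: eventually_mono)
  then have "0 \<le> \<epsilon> * (\<integral>x. c \<bullet> x \<partial>\<mu>)" using \<epsilon> by simp
  moreover have "0 \<le> \<delta> * (\<integral>x. norm (perp c x) \<partial>\<mu>)" using \<delta> by simp
  moreover have "2 * \<epsilon> * (\<integral>x. c \<bullet> x \<partial>\<mu>) + 2 * \<delta> * (\<integral>x. norm (perp c x) \<partial>\<mu>) \<le> 4 * K\<^sup>2"
    using f 1 2 by simp
  ultimately show "\<epsilon> * (\<integral>x. c \<bullet> x \<partial>\<mu>) \<le> 2 * K\<^sup>2" "\<delta> * (\<integral>x. norm (perp c x) \<partial>\<mu>) \<le> 2 * K\<^sup>2"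
    by linarith+
qed

lemma cubic_bound:
  fixes g p :: real assumes "0 \<le> g" "0 \<le> p"
  shows "g * p\<^sup>2 - 4 * \<delta> * p^3 \<le> g^3 / (16 * \<delta>\<^sup>2)"
proof (cases "g \<le> 4 * \<delta> * p")
  case True
  then have "p\<^sup>2 * g \<le> p\<^sup>2 * (4 * \<delta> * p)" by (intro mult_left_mono) auto
  moreover have "0 \<le> g^3 / (16 * \<delta>\<^sup>2)" using assms by simp
  ultimately show ?thesis by (simp add: power2_eq_square power3_eq_cube algebra_simps)
next
  case False
  then have "p \<le> g / (4 * \<delta>)" using \<delta> by (simp add: field_simps)
  then have "g * p\<^sup>2 \<le> g * (g / (4 * \<delta>))\<^sup>2"
    using assms by (intro mult_left_mono power_mono) auto
  also have "\<dots> = g^3 / (16 * \<delta>\<^sup>2)"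
    by (simp add: power2_eq_square power3_eq_cube)
  finally show ?thesis using assms \<delta> by (smt (verit) mult_nonneg_nonneg zero_le_power)
qed

text \<open>First moments of the orthogonal component would not suffice later on: it is multiplied there by
  losses of small mean, and the product has a small mean only by uniform integrability.\<close>
lemma second_moment:
  shows integrable_perp_square: "integrable \<mu> (\<lambda>x. (norm (perp c x))\<^sup>2)"
    and perp_square_bound: "(\<integral>x. (norm (perp c x))\<^sup>2 \<partial>\<mu>) \<le> D"
proof -
  have D0: "0 \<le> D" by (simp add: collapse_bound_def)
  have d: "AE x in \<mu>. 0 \<le> (norm (perp c x))\<^sup>2 \<and> integrable M (\<lambda>\<omega>. (norm (perp c (next_queue (x, \<omega>))))^4) \<and>
      (\<integral>\<omega>. (norm (perp c (next_queue (x, \<omega>))))^4 \<partial>M) \<le> (norm (perp c x))^4 - (norm (perp c x))\<^sup>2 + D"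
    using AE_nonneg
  proof eventually_elim
    case (elim x)
    let ?p = "norm (perp c x)"
    have [measurable]: "(\<lambda>\<omega>. next_queue (x, \<omega>)) \<in> borel_measurable M" by simp
    have i: "integrable M (\<lambda>\<omega>. (norm (perp c (next_queue (x, \<omega>))))^4)"
      using norm_next_queue_le[OF elim] norm_perp_le[OF norm_c]
      by (intro M2.integrable_const_bound[of _ "(norm x + 3 * K)^4"] AE_I2)
        (auto intro!: power_mono intro: order_trans)
    have i': "integrable M (\<lambda>\<omega>. perp c x \<bullet> (A \<omega> - srv x \<omega>))" using integrable_A integrable_srv by auto
    have "(\<integral>\<omega>. (norm (perp c (next_queue (x, \<omega>))))^4 \<partial>M)
      \<le> (\<integral>\<omega>. ?p^4 + 4 * ?p\<^sup>2 * (perp c x \<bullet> (A \<omega> - srv x \<omega>)) + 94 * K\<^sup>2 * ?p\<^sup>2 + 162 * K^4 \<partial>M)"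
      using i i' slot_bounds.perp_fourth_step[OF slot[OF elim]]
      by (intro integral_mono) (auto simp: next_queue_def)
    also have "\<dots> = ?p^4 + 4 * ?p\<^sup>2 * (\<integral>\<omega>. perp c x \<bullet> (A \<omega> - srv x \<omega>) \<partial>M) + 94 * K\<^sup>2 * ?p\<^sup>2 + 162 * K^4"
      using i' M2.prob_space by simp
    also have "4 * ?p\<^sup>2 * (\<integral>\<omega>. perp c x \<bullet> (A \<omega> - srv x \<omega>) \<partial>M) \<le> 4 * ?p\<^sup>2 * (- \<delta> * ?p)"
      by (intro mult_left_mono mean_perp_drift elim) auto
    finally have "(\<integral>\<omega>. (norm (perp c (next_queue (x, \<omega>))))^4 \<partial>M)
      \<le> ?p^4 + 4 * ?p\<^sup>2 * (- \<delta> * ?p) + 94 * K\<^sup>2 * ?p\<^sup>2 + 162 * K^4" by simp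
    moreover have "4 * ?p\<^sup>2 * (- \<delta> * ?p) = - (4 * \<delta> * ?p^3)"
      by (simp add: power2_eq_square power3_eq_cube)
    moreover have "94 * K\<^sup>2 * ?p\<^sup>2 - 4 * \<delta> * ?p^3 + ?p\<^sup>2 \<le> (94 * K\<^sup>2 + 1)^3 / (16 * \<delta>\<^sup>2)"
      using cubic_bound[of "94 * K\<^sup>2 + 1" ?p] by (simp add: distrib_right)
    ultimately have "(\<integral>\<omega>. (norm (perp c (next_queue (x, \<omega>))))^4 \<partial>M) \<le> ?p^4 - ?p\<^sup>2 + D"
      unfolding collapse_bound_def by linarith
    then show ?case using i by simp
  qed
  show "integrable \<mu> (\<lambda>x. (norm (perp c x))\<^sup>2)" "(\<integral>x. (norm (perp c x))\<^sup>2 \<partial>\<mu>) \<le> D"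
    using stationary_drift[OF M1.prob_space_axioms M2.prob_space_axioms _ distr_next_queue _ _ _ D0 d] by auto
qed

definition idle_work :: "(real ^ 'n) \<times> 'w \<Rightarrow> real" where
  "idle_work z = c \<bullet> unused (fst z) (A (snd z)) (srv (fst z) (snd z))"

definition mismatch :: "(real ^ 'n) \<times> 'w \<Rightarrow> real" where
  "mismatch z = B (snd z) - c \<bullet> srv (fst z) (snd z)"

definition net_input :: "'w \<Rightarrow> real" where
  "net_input \<omega> = c \<bullet> A \<omega> - B \<omega>"

lemma slot_variables_measurable [measurable]:
  "idle_work \<in> borel_measurable Q" "mismatch \<in> borel_measurable Q" "net_input \<in> borel_measurable M"
  unfolding idle_work_def mismatch_def net_input_def unused_def by measurable

text \<open>Only the net input is independent of the queue lengths. The other two terms are nonnegative and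
  keep the workload \<open>c \<bullet> x\<close> from drifting to \<open>- \<infinity>\<close>.\<close>
lemma workload_step: "c \<bullet> next_queue z = c \<bullet> fst z + net_input (snd z) + mismatch z + idle_work z"
  unfolding next_queue_def idle_work_def mismatch_def net_input_def queue_step_eq by (simp add: inner_add_right inner_diff_right)

lemma slot_losses:
  assumes "0 \<le> fst z \<and> snd z \<in> space M"
  shows "0 \<le> idle_work z" "idle_work z \<le> K" "0 \<le> mismatch z" "mismatch z \<le> K" "\<bar>net_input (snd z)\<bar> \<le> K"
    and "(c \<bullet> next_queue z) * idle_work z \<le> \<kappa> * idle_work z * norm (perp c (next_queue z))"
    and "(c \<bullet> fst z) * mismatch z \<le> \<kappa> * mismatch z * norm (perp c (fst z))"
proof -
  interpret slot_bounds "fst z" "A (snd z)" "srv (fst z) (snd z)" c K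
    using assms by (intro slot) auto
  have \<omega>: "snd z \<in> space M" using assms by simp
  show "0 \<le> idle_work z" unfolding idle_work_def by (rule inner_nonneg_vec[OF c0 unused_nonneg])
  show "idle_work z \<le> K" unfolding idle_work_def using inner_nonneg_le_norm[OF c1, of u] norm_u by linarith
  show "0 \<le> mismatch z" unfolding mismatch_def using srv_le_B[OF \<omega>] by simp
  show "mismatch z \<le> K" unfolding mismatch_def using B_bound[OF \<omega>] inner_nonneg_vec[OF c0 s] by linarith
  show "\<bar>net_input (snd z)\<bar> \<le> K" unfolding net_input_def
    using B_bound[OF \<omega>] B_nonneg[OF \<omega>] inner_nonneg_vec[OF c0 \<alpha>] inner_nonneg_le_norm[OF c1, of "A (snd z)"] \<alpha>K
    by linarith
  show "(c \<bullet> next_queue z) * idle_work z \<le> \<kappa> * idle_work z * norm (perp c (next_queue z))"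
    unfolding next_queue_def idle_work_def by (rule unused_alignment) (rule \<kappa>_c)
  show "(c \<bullet> fst z) * mismatch z \<le> \<kappa> * mismatch z * norm (perp c (fst z))"
    unfolding mismatch_def using assms by (intro alignment) auto
qed

lemma integrable_losses: "integrable Q idle_work" "integrable Q mismatch" "integrable M net_input"
proof -
  have "AE z in Q. norm (idle_work z) \<le> K"
    using AE_nonneg_slot by eventually_elim (use slot_losses in auto)
  then show "integrable Q idle_work"
    by (rule P.integrable_const_bound) simp
  have "AE z in Q. norm (mismatch z) \<le> K"
    using AE_nonneg_slot by eventually_elim (use slot_losses in auto)
  then show "integrable Q mismatch"
    by (rule P.integrable_const_bound) simp
  show "integrable M net_input"
    unfolding net_input_def using integrable_A integrable_B by auto
qed

lemma mean_net_input: "(\<integral>\<omega>. net_input \<omega> \<partial>M) = - \<epsilon>"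
  unfolding net_input_def using integrable_A integrable_B norm_c
  by (simp add: mean_A mean_B inner_diff_right dot_square_norm)

text \<open>The mean workload is stationary and finite, so the losses make up for the mean net input.\<close>
lemma mean_losses: "(\<integral>z. idle_work z + mismatch z \<partial>Q) = \<epsilon>"
proof -
  have i: "integrable Q (\<lambda>z. c \<bullet> fst z)" "integrable Q (\<lambda>z. c \<bullet> next_queue z)" "integrable Q (\<lambda>z. net_input (snd z))"
    using integral_queue(2)[of "\<lambda>x. c \<bullet> x"] integral_next_queue(2)[of "\<lambda>x. c \<bullet> x"] integrable_workload
      integral_noise(2)[of net_input] integrable_losses(3) by auto
  have "(\<integral>z. idle_work z + mismatch z \<partial>Q) = (\<integral>z. (c \<bullet> next_queue z) - (c \<bullet> fst z) - net_input (snd z) \<partial>Q)"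
    by (rule Bochner_Integration.integral_cong) (auto simp: workload_step)
  also have "\<dots> = (\<integral>z. c \<bullet> next_queue z \<partial>Q) - (\<integral>z. c \<bullet> fst z \<partial>Q) - (\<integral>z. net_input (snd z) \<partial>Q)"
    using i by simp
  also have "\<dots> = \<epsilon>"
    using integral_queue(1)[of "\<lambda>x. c \<bullet> x"] integral_next_queue(1)[of "\<lambda>x. c \<bullet> x"]
      integral_noise(1)[of net_input] by (simp add: mean_net_input)
  finally show ?thesis .
qed

definition \<phi> :: "real \<Rightarrow> complex" where
  "\<phi> h = (\<integral>x. iexp (h * (c \<bullet> x)) \<partial>\<mu>)"

lemma norm_\<phi>_le: "norm (\<phi> h) \<le> 1"
proof -
  have "norm (\<phi> h) \<le> (\<integral>x. norm (iexp (h * (c \<bullet> x))) \<partial>\<mu>)"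
    unfolding \<phi>_def by (rule integral_norm_bound)
  also have "\<dots> = 1" using M1.prob_space by (simp add: norm_iexp)
  finally show ?thesis .
qed

lemma net_input_bound: "\<omega> \<in> space M \<Longrightarrow> \<bar>net_input \<omega>\<bar> \<le> K"
  using slot_losses(5)[of "(0, \<omega>)"] by simp

lemma noise_expansion:
  "norm ((\<integral>\<omega>. iexp (h * net_input \<omega>) \<partial>M) - (1 - \<i> * (h * \<epsilon>) - h\<^sup>2 * (\<integral>\<omega>. (net_input \<omega>)\<^sup>2 \<partial>M) / 2)) \<le> \<bar>h\<bar>^3 * K^3 / 6"
proof -
  have i1: "integrable M (\<lambda>\<omega>. iexp (h * net_input \<omega>))"
    by (rule M2.integrable_const_bound[of _ 1]) (auto simp: norm_iexp)
  have i2: "integrable M (\<lambda>\<omega>. complex_of_real (net_input \<omega>))"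
    using integrable_losses(3) by simp
  have "integrable M (\<lambda>\<omega>. (net_input \<omega>)\<^sup>2)"
  proof (rule M2.integrable_const_bound[of _ "K\<^sup>2"])
    show "AE \<omega> in M. norm ((net_input \<omega>)\<^sup>2) \<le> K\<^sup>2"
      using net_input_bound by (intro AE_I2) (simp add: abs_le_square_iff[symmetric] K_nonneg)
  qed simp
  then have i3: "integrable M (\<lambda>\<omega>. complex_of_real ((net_input \<omega>)\<^sup>2))"
    by (rule integrable_of_real)
  have remainder: "(\<integral>\<omega>. iexp (h * net_input \<omega>) \<partial>M) - (1 - \<i> * (h * \<epsilon>) - h\<^sup>2 * (\<integral>\<omega>. (net_input \<omega>)\<^sup>2 \<partial>M) / 2)
    = (\<integral>\<omega>. iexp (h * net_input \<omega>) - 1 - (\<i> * h) * complex_of_real (net_input \<omega>) + (h\<^sup>2 / 2) * complex_of_real ((net_input \<omega>)\<^sup>2) \<partial>M)"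
  proof -
    have eq: "(\<integral>\<omega>. iexp (h * net_input \<omega>) - 1 - (\<i> * h) * complex_of_real (net_input \<omega>) + (h\<^sup>2 / 2) * complex_of_real ((net_input \<omega>)\<^sup>2) \<partial>M)
      = (\<integral>\<omega>. iexp (h * net_input \<omega>) \<partial>M) - 1 - (\<i> * h) * (\<integral>\<omega>. complex_of_real (net_input \<omega>) \<partial>M)
        + (h\<^sup>2 / 2) * (\<integral>\<omega>. complex_of_real ((net_input \<omega>)\<^sup>2) \<partial>M)"
      using i1 i2 i3 M2.prob_space by simp
    have m: "(\<integral>\<omega>. complex_of_real (net_input \<omega>) \<partial>M) = complex_of_real (- \<epsilon>)"
      "(\<integral>\<omega>. complex_of_real ((net_input \<omega>)\<^sup>2) \<partial>M) = complex_of_real (\<integral>\<omega>. (net_input \<omega>)\<^sup>2 \<partial>M)"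
      by (simp_all only: integral_complex_of_real mean_net_input)
    show ?thesis unfolding eq m by simp
  qed
  have "norm ((\<integral>\<omega>. iexp (h * net_input \<omega>) \<partial>M) - (1 - \<i> * (h * \<epsilon>) - h\<^sup>2 * (\<integral>\<omega>. (net_input \<omega>)\<^sup>2 \<partial>M) / 2))
    \<le> (\<integral>\<omega>. norm (iexp (h * net_input \<omega>) - 1 - (\<i> * h) * complex_of_real (net_input \<omega>) + (h\<^sup>2 / 2) * complex_of_real ((net_input \<omega>)\<^sup>2)) \<partial>M)"
    unfolding remainder by (rule integral_norm_bound)
  also have "\<dots> \<le> (\<integral>\<omega>. \<bar>h\<bar>^3 * K^3 / 6 \<partial>M)"
  proof (rule integral_mono)
    fix \<omega> assume \<omega>: "\<omega> \<in> space M"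
    have "norm (iexp (h * net_input \<omega>) - 1 - (\<i> * h) * complex_of_real (net_input \<omega>) + (h\<^sup>2 / 2) * complex_of_real ((net_input \<omega>)\<^sup>2))
      \<le> \<bar>h * net_input \<omega>\<bar>^3 / 6"
      using iexp_quadratic[of "h * net_input \<omega>"] by (simp add: power_mult_distrib mult.assoc)
    also have "\<dots> \<le> \<bar>h\<bar>^3 * K^3 / 6"
      using net_input_bound[OF \<omega>] unfolding abs_mult power_mult_distrib
      by (intro divide_right_mono mult_left_mono power_mono) auto
    finally show "norm (iexp (h * net_input \<omega>) - 1 - (\<i> * h) * complex_of_real (net_input \<omega>) + (h\<^sup>2 / 2) * complex_of_real ((net_input \<omega>)\<^sup>2))
      \<le> \<bar>h\<bar>^3 * K^3 / 6" .
  qed (use i1 i2 i3 in auto)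
  finally show ?thesis using M2.prob_space by simp
qed

text \<open>With \<open>e = sqrt \<epsilon>\<close> and a loss \<open>v\<close> of mean at most \<open>\<epsilon>\<close>, both terms are of order
  \<open>sqrt \<epsilon>\<close> in the mean once the second moment of \<open>p\<close> is bounded.\<close>
lemma scaled_product_le:
  fixes v p e :: real
  assumes e: "0 < e" and "0 \<le> v" "v \<le> K"
  shows "v * p \<le> e * p\<^sup>2 + K / (4 * e) * v"
proof -
  have "(4 * e) * (e * p\<^sup>2 + v\<^sup>2 / (4 * e) - v * p) = (2 * e * p - v)\<^sup>2"
    using e by (simp add: power2_eq_square algebra_simps)
  then have "0 \<le> (4 * e) * (e * p\<^sup>2 + v\<^sup>2 / (4 * e) - v * p)" by simp
  then have "v * p \<le> e * p\<^sup>2 + v\<^sup>2 / (4 * e)" using e by (simp add: zero_le_mult_iff)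
  also have "v\<^sup>2 / (4 * e) \<le> K * v / (4 * e)"
    using assms by (intro divide_right_mono) (auto simp: power2_eq_square mult_right_mono)
  finally show ?thesis by simp
qed

abbreviation "C \<equiv> transform_error \<delta> K \<kappa>"

text \<open>Both queue lengths of the slot have law \<open>\<mu>\<close>, hence the same transform, and the net input
  factors out by independence.\<close>
lemma step_expansion:
  "norm (\<phi> h - \<phi> h * (\<integral>\<omega>. iexp (h * net_input \<omega>) \<partial>M) - \<i> * (h * \<epsilon>)) \<le> h\<^sup>2 * (C * sqrt \<epsilon>)"
proof -
  let ?e = "sqrt \<epsilon>"
  have e: "0 < ?e" "?e * ?e = \<epsilon>" "\<epsilon> \<le> ?e" using \<epsilon> by (auto simp: real_le_rsqrt power2_eq_square mult_left_le)
  have iX': "integrable Q (\<lambda>z. iexp (h * (c \<bullet> next_queue z)))"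
    by (rule P.integrable_const_bound[of _ 1]) (auto simp: norm_iexp)
  have iXZ: "integrable Q (\<lambda>z. iexp (h * (c \<bullet> fst z)) * iexp (h * net_input (snd z)))"
    by (rule P.integrable_const_bound[of _ 1]) (auto simp: norm_iexp norm_mult)
  have iL: "integrable Q (\<lambda>z. complex_of_real (h * (idle_work z + mismatch z)))"
    using integrable_losses by simp
  have X': "(\<integral>z. iexp (h * (c \<bullet> next_queue z)) \<partial>Q) = \<phi> h"
    unfolding \<phi>_def using integral_next_queue(1)[of "\<lambda>x. iexp (h * (c \<bullet> x))"] by simp
  have XZ: "(\<integral>z. iexp (h * (c \<bullet> fst z)) * iexp (h * net_input (snd z)) \<partial>Q) = \<phi> h * (\<integral>\<omega>. iexp (h * net_input \<omega>) \<partial>M)"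
    using integral_fst'[OF iXZ] by (simp add: \<phi>_def)
  have L: "(\<integral>z. complex_of_real (h * (idle_work z + mismatch z)) \<partial>Q) = h * \<epsilon>"
    by (simp only: integral_complex_of_real integral_mult_right_zero mean_losses)
  let ?R = "\<lambda>z. h\<^sup>2 * (\<kappa> * ?e * ((norm (perp c (next_queue z)))\<^sup>2 + (norm (perp c (fst z)))\<^sup>2)
    + (\<kappa> * K / (4 * ?e) + 2 * K) * (idle_work z + mismatch z))"
  have i2: "integrable Q (\<lambda>z. (norm (perp c (next_queue z)))\<^sup>2)" "integrable Q (\<lambda>z. (norm (perp c (fst z)))\<^sup>2)"
    using integrable_perp_square integral_next_queue(2)[of "\<lambda>x. (norm (perp c x))\<^sup>2"]
      integral_queue(2)[of "\<lambda>x. (norm (perp c x))\<^sup>2"] by auto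
  have iR: "integrable Q ?R" using i2 integrable_losses by auto
  have increment: "\<phi> h - \<phi> h * (\<integral>\<omega>. iexp (h * net_input \<omega>) \<partial>M) - \<i> * (h * \<epsilon>)
    = (\<integral>z. iexp (h * (c \<bullet> next_queue z)) - iexp (h * (c \<bullet> fst z)) * iexp (h * net_input (snd z))
        - \<i> * complex_of_real (h * (idle_work z + mismatch z)) \<partial>Q)"
    unfolding Bochner_Integration.integral_diff[OF Bochner_Integration.integrable_diff[OF iX' iXZ]
      integrable_mult_right[OF iL]] Bochner_Integration.integral_diff[OF iX' iXZ]
      integral_mult_right_zero X' XZ L ..
  have "norm (\<phi> h - \<phi> h * (\<integral>\<omega>. iexp (h * net_input \<omega>) \<partial>M) - \<i> * (h * \<epsilon>)) \<le> (\<integral>z. norm (iexp (h * (c \<bullet> next_queue z)) - iexp (h * (c \<bullet> fst z)) * iexp (h * net_input (snd z))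
        - \<i> * complex_of_real (h * (idle_work z + mismatch z))) \<partial>Q)"
    unfolding increment by (rule integral_norm_bound)
  also have "\<dots> \<le> (\<integral>z. ?R z \<partial>Q)"
  proof (rule integral_mono_AE)
    show "AE z in Q. norm (iexp (h * (c \<bullet> next_queue z)) - iexp (h * (c \<bullet> fst z)) * iexp (h * net_input (snd z))
        - \<i> * complex_of_real (h * (idle_work z + mismatch z))) \<le> ?R z"
      using AE_nonneg_slot
    proof eventually_elim
      case (elim z)
      note b = slot_losses[OF elim]
      have X: "0 \<le> c \<bullet> fst z" "0 \<le> c \<bullet> next_queue z"
        using elim by (auto intro!: inner_nonneg_vec c_nonneg simp: next_queue_def queue_step_nonneg)
      have "norm (iexp (h * (c \<bullet> next_queue z)) - iexp (h * (c \<bullet> fst z)) * iexp (h * net_input (snd z))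
        - \<i> * complex_of_real (h * (idle_work z + mismatch z)))
        \<le> h\<^sup>2 * ((c \<bullet> next_queue z) * idle_work z + (idle_work z)\<^sup>2 / 2 + (c \<bullet> fst z) * mismatch z + \<bar>net_input (snd z)\<bar> * mismatch z + (mismatch z)\<^sup>2 / 2)"
        by (rule iexp_step_estimate[OF workload_step X b(3,1)])
      also have "\<dots> \<le> ?R z"
      proof (rule mult_left_mono)
        have w: "(c \<bullet> next_queue z) * idle_work z \<le> \<kappa> * (?e * (norm (perp c (next_queue z)))\<^sup>2 + K / (4 * ?e) * idle_work z)"
          using b(6) mult_left_mono[OF scaled_product_le[OF e(1) b(1,2), of "norm (perp c (next_queue z))"] \<kappa>]
          by (simp add: mult.assoc)
        have y: "(c \<bullet> fst z) * mismatch z \<le> \<kappa> * (?e * (norm (perp c (fst z)))\<^sup>2 + K / (4 * ?e) * mismatch z)"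
          using b(7) mult_left_mono[OF scaled_product_le[OF e(1) b(3,4), of "norm (perp c (fst z))"] \<kappa>]
          by (simp add: mult.assoc)
        have w2: "(idle_work z)\<^sup>2 \<le> K * idle_work z" "(mismatch z)\<^sup>2 \<le> K * mismatch z" "\<bar>net_input (snd z)\<bar> * mismatch z \<le> K * mismatch z"
          using b(1-5) by (auto simp: power2_eq_square intro!: mult_right_mono)
        have k: "0 \<le> K * idle_work z" "0 \<le> K * mismatch z" using b(1,3) K_nonneg by auto
        have "(c \<bullet> next_queue z) * idle_work z + (idle_work z)\<^sup>2 / 2 + (c \<bullet> fst z) * mismatch z + \<bar>net_input (snd z)\<bar> * mismatch z + (mismatch z)\<^sup>2 / 2
          \<le> \<kappa> * (?e * (norm (perp c (next_queue z)))\<^sup>2 + K / (4 * ?e) * idle_work z)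
            + \<kappa> * (?e * (norm (perp c (fst z)))\<^sup>2 + K / (4 * ?e) * mismatch z) + 2 * (K * idle_work z) + 2 * (K * mismatch z)"
          using w y w2 k by linarith
        also have "\<dots> = \<kappa> * ?e * ((norm (perp c (next_queue z)))\<^sup>2 + (norm (perp c (fst z)))\<^sup>2)
          + (\<kappa> * K / (4 * ?e) + 2 * K) * (idle_work z + mismatch z)"
          by (simp add: algebra_simps add_divide_distrib)
        finally show "(c \<bullet> next_queue z) * idle_work z + (idle_work z)\<^sup>2 / 2 + (c \<bullet> fst z) * mismatch z + \<bar>net_input (snd z)\<bar> * mismatch z + (mismatch z)\<^sup>2 / 2
          \<le> \<kappa> * ?e * ((norm (perp c (next_queue z)))\<^sup>2 + (norm (perp c (fst z)))\<^sup>2)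
          + (\<kappa> * K / (4 * ?e) + 2 * K) * (idle_work z + mismatch z)" .
      qed simp
      finally show ?case .
    qed
  qed (use iX' iXZ iL iR in auto)
  also have "\<dots> = h\<^sup>2 * (\<kappa> * ?e * (2 * (\<integral>x. (norm (perp c x))\<^sup>2 \<partial>\<mu>)) + (\<kappa> * K / (4 * ?e) + 2 * K) * \<epsilon>)"
  proof -
    have "(\<integral>z. (norm (perp c (next_queue z)))\<^sup>2 + (norm (perp c (fst z)))\<^sup>2 \<partial>Q) = 2 * (\<integral>x. (norm (perp c x))\<^sup>2 \<partial>\<mu>)"
      using i2 by (simp add: integral_next_queue(1)[of "\<lambda>x. (norm (perp c x))\<^sup>2"]
        integral_queue(1)[of "\<lambda>x. (norm (perp c x))\<^sup>2"])
    then show ?thesis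
      using i2 integrable_losses
      by (subst integral_mult_right_zero, subst Bochner_Integration.integral_add)
        (simp_all only: integral_mult_right_zero mean_losses integrable_mult_right Bochner_Integration.integrable_add)
  qed
  also have "\<dots> \<le> h\<^sup>2 * (C * ?e)"
  proof (rule mult_left_mono)
    have "\<kappa> * ?e * (2 * (\<integral>x. (norm (perp c x))\<^sup>2 \<partial>\<mu>)) \<le> \<kappa> * ?e * (2 * D)"
      using \<kappa> e perp_square_bound by (intro mult_left_mono) auto
    moreover have "\<kappa> * K / (4 * ?e) * \<epsilon> \<le> \<kappa> * K * ?e"
    proof -
      have "\<kappa> * K / (4 * ?e) * \<epsilon> = \<kappa> * K * ?e / 4"
      proof -
        have "\<kappa> * K / (4 * ?e) * \<epsilon> = \<kappa> * K / 4 * (\<epsilon> / ?e)" by simp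
        also have "\<epsilon> / ?e = ?e" using \<epsilon> by (simp add: real_div_sqrt)
        finally show ?thesis by simp
      qed
      moreover have "\<kappa> * K * ?e / 4 \<le> \<kappa> * K * ?e" using \<kappa> K_nonneg e by simp
      ultimately show ?thesis by (simp only:)
    qed
    moreover have "2 * K * \<epsilon> \<le> 2 * K * ?e" using K_nonneg e by (intro mult_left_mono) auto
    ultimately show "\<kappa> * ?e * (2 * (\<integral>x. (norm (perp c x))\<^sup>2 \<partial>\<mu>)) + (\<kappa> * K / (4 * ?e) + 2 * K) * \<epsilon> \<le> C * ?e"
      unfolding transform_error_def by (simp add: algebra_simps)
  qed simp
  finally show ?thesis .
qed

text \<open>For \<open>h = \<epsilon> * \<theta>\<close> the terms \<open>\<i> * h * \<epsilon>\<close> and \<open>h\<^sup>2 / 2\<close> times the second moment of the net input are both of order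
  \<open>\<epsilon>\<^sup>2\<close>; this is why \<open>1 / \<epsilon>\<close> is the right scale of the workload.\<close>
theorem transform_estimate:
  "norm (\<phi> (\<epsilon> * \<theta>) * (\<i> * \<theta> + \<theta>\<^sup>2 * (\<integral>\<omega>. (net_input \<omega>)\<^sup>2 \<partial>M) / 2) - \<i> * \<theta>)
    \<le> (\<theta>\<^sup>2 * C + \<bar>\<theta>\<bar>^3 * K^3) * sqrt \<epsilon>"
proof -
  define h where "h = \<epsilon> * \<theta>"
  define \<sigma> where "\<sigma> = (\<integral>\<omega>. (net_input \<omega>)\<^sup>2 \<partial>M)"
  define e where "e = (\<integral>\<omega>. iexp (h * net_input \<omega>) \<partial>M)"
  define E1 where "E1 = \<phi> h - \<phi> h * e - \<i> * (h * \<epsilon>)"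
  define E2 where "E2 = e - (1 - \<i> * (h * \<epsilon>) - h\<^sup>2 * \<sigma> / 2)"
  have "\<phi> h * (\<i> * (h * \<epsilon>) + h\<^sup>2 * \<sigma> / 2) - \<i> * (h * \<epsilon>) = E1 + \<phi> h * E2"
    unfolding E1_def E2_def by (simp add: algebra_simps)
  also have "norm \<dots> \<le> norm E1 + norm (\<phi> h) * norm E2"
    using norm_triangle_ineq[of E1 "\<phi> h * E2"] by (simp only: norm_mult)
  also have "\<dots> \<le> h\<^sup>2 * (C * sqrt \<epsilon>) + 1 * (\<bar>h\<bar>^3 * K^3 / 6)"
    using step_expansion[of h] noise_expansion[of h] norm_\<phi>_le[of h]
    unfolding E1_def E2_def e_def \<sigma>_def by (intro add_mono mult_mono) auto
  finally have n: "norm (\<phi> h * (\<i> * (h * \<epsilon>) + h\<^sup>2 * \<sigma> / 2) - \<i> * (h * \<epsilon>))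
    \<le> h\<^sup>2 * (C * sqrt \<epsilon>) + \<bar>h\<bar>^3 * K^3 / 6" by simp
  have "\<phi> h * (\<i> * (h * \<epsilon>) + h\<^sup>2 * \<sigma> / 2) - \<i> * (h * \<epsilon>)
    = of_real (\<epsilon>\<^sup>2) * (\<phi> h * (\<i> * \<theta> + \<theta>\<^sup>2 * \<sigma> / 2) - \<i> * \<theta>)"
    unfolding h_def by (simp add: power2_eq_square algebra_simps)
  then have "\<epsilon>\<^sup>2 * norm (\<phi> h * (\<i> * \<theta> + \<theta>\<^sup>2 * \<sigma> / 2) - \<i> * \<theta>)
    \<le> h\<^sup>2 * (C * sqrt \<epsilon>) + \<bar>h\<bar>^3 * K^3 / 6"
    using n \<epsilon> by (simp add: norm_mult norm_power)
  also have "\<bar>h\<bar>^3 * K^3 / 6 \<le> \<epsilon>\<^sup>2 * (\<bar>\<theta>\<bar>^3 * K^3 * sqrt \<epsilon>)"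
  proof -
    have "\<epsilon> \<le> sqrt \<epsilon>" using \<epsilon> by (simp add: real_le_rsqrt power2_eq_square mult_left_le)
    have "\<bar>h\<bar>^3 * K^3 / 6 = \<epsilon>\<^sup>2 * (\<bar>\<theta>\<bar>^3 * K^3 * (\<epsilon> / 6))"
      using \<epsilon> unfolding h_def by (simp add: abs_mult power_mult_distrib power2_eq_square power3_eq_cube)
    also have "\<dots> \<le> \<epsilon>\<^sup>2 * (\<bar>\<theta>\<bar>^3 * K^3 * sqrt \<epsilon>)"
      using \<open>\<epsilon> \<le> sqrt \<epsilon>\<close> \<epsilon> K_nonneg by (intro mult_left_mono) auto
    finally show ?thesis .
  qed
  also have "h\<^sup>2 * (C * sqrt \<epsilon>) + \<epsilon>\<^sup>2 * (\<bar>\<theta>\<bar>^3 * K^3 * sqrt \<epsilon>) = \<epsilon>\<^sup>2 * ((\<theta>\<^sup>2 * C + \<bar>\<theta>\<bar>^3 * K^3) * sqrt \<epsilon>)"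
    unfolding h_def by (simp add: power_mult_distrib algebra_simps)
  finally show ?thesis
    using \<epsilon> unfolding h_def \<sigma>_def by simp
qed

end

section \<open>Facets and the capacity region\<close>

lemma finite_positive_lower_bound:
  fixes A :: "real set"
  assumes "finite A"
  obtains g where "0 < g" "\<And>x. x \<in> A \<Longrightarrow> 0 < x \<Longrightarrow> g \<le> x"
proof
  let ?P = "insert 1 {x \<in> A. 0 < x}"
  have "finite ?P" using assms by simp
  then show "0 < Min ?P" by (subst Min_gr_iff) auto
  show "Min ?P \<le> x" if "x \<in> A" "0 < x" for x
    using that \<open>finite ?P\<close> by (intro Min_le) auto
qed

text \<open>Otherwise halfspace \<open>l\<close> could be dropped, which would leave a shorter description.\<close>
lemma irredundant_halfspace:
  assumes min: "minimal_halfspace_description C L c b" and l: "l \<in> {1..L}"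
  obtains y where "0 \<le> y" "\<And>m. m \<in> {1..L} \<Longrightarrow> m \<noteq> l \<Longrightarrow> c m \<bullet> y \<le> b m" "b l < c l \<bullet> y"
proof (rule ccontr)
  assume not: "\<not> thesis"
  note witness = that
  have *: "c l \<bullet> y \<le> b l" if "0 \<le> y" "\<And>m. m \<in> {1..L} \<Longrightarrow> m \<noteq> l \<Longrightarrow> c m \<bullet> y \<le> b m" for y
    using witness[OF that] not by (meson not_le_imp_less)
  have desc: "halfspace_description C L c b" using min by (simp add: minimal_halfspace_description_def)
  \<comment> \<open>Renumbers the remaining halfspaces.\<close>
  define skip where "skip m = (if m < l then m else Suc m)" for m
  have skip: "skip ` {1..L - 1} = {1..L} - {l}"
  proof
    show "skip ` {1..L - 1} \<subseteq> {1..L} - {l}" using l by (auto simp: skip_def)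
    show "{1..L} - {l} \<subseteq> skip ` {1..L - 1}"
    proof
      fix m assume m: "m \<in> {1..L} - {l}"
      show "m \<in> skip ` {1..L - 1}"
      proof (cases "m < l")
        case True
        then show ?thesis using m l by (intro image_eqI[of _ _ m]) (auto simp: skip_def)
      next
        case False
        then show ?thesis using m l by (intro image_eqI[of _ _ "m - 1"]) (auto simp: skip_def)
      qed
    qed
  qed
  have all_skip: "(\<forall>m\<in>{1..L - 1}. P (skip m)) \<longleftrightarrow> (\<forall>m\<in>{1..L} - {l}. P m)" for P
    unfolding skip[symmetric] by simp
  have "halfspace_description C (L - 1) (c \<circ> skip) (b \<circ> skip)"
    unfolding halfspace_description_def o_def
  proof
    show "\<forall>m\<in>{1..L - 1}. 0 \<le> c (skip m) \<and> norm (c (skip m)) = 1 \<and> 0 < b (skip m)"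
      using desc by (subst all_skip) (auto simp: halfspace_description_def)
    have "C = {x. 0 \<le> x \<and> (\<forall>m\<in>{1..L} - {l}. c m \<bullet> x \<le> b m)}"
      using desc * unfolding halfspace_description_def by blast
    also have "\<dots> = {x. 0 \<le> x \<and> (\<forall>m\<in>{1..L - 1}. c (skip m) \<bullet> x \<le> b (skip m))}"
      by (simp only: all_skip[of "\<lambda>m. c m \<bullet> x \<le> b m" for x])
    finally show "C = {x. 0 \<le> x \<and> (\<forall>m\<in>{1..L - 1}. c (skip m) \<bullet> x \<le> b (skip m))}" .
  qed
  then have "L \<le> L - 1" using min by (auto simp: minimal_halfspace_description_def)
  then show False using l by auto
qed

text \<open>A small positive vector \<open>z\<close> satisfies all constraints strictly. On the way from \<open>z\<close> to a point \<open>y\<close>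
  that violates constraint \<open>l\<close> only, the first point \<open>w\<close> on the hyperplane still satisfies all the others
  strictly and has positive components.\<close>
lemma facet_has_full_dimension:
  assumes min: "minimal_halfspace_description C L c b" and l: "l \<in> {1..L}"
  obtains w \<rho> where "0 < \<rho>" "\<And>x. c l \<bullet> x = b l \<Longrightarrow> dist w x < \<rho> \<Longrightarrow> x \<in> facet C (c l) (b l)"
    "w \<in> facet C (c l) (b l)"
proof -
  have desc: "halfspace_description C L c b" using min by (simp add: minimal_halfspace_description_def)
  then have c: "\<And>m. m \<in> {1..L} \<Longrightarrow> 0 \<le> c m \<and> norm (c m) = 1 \<and> 0 < b m"
    and C: "C = {x. 0 \<le> x \<and> (\<forall>m\<in>{1..L}. c m \<bullet> x \<le> b m)}"
    by (auto simp: halfspace_description_def)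
  obtain y where y: "0 \<le> y" "\<And>m. m \<in> {1..L} \<Longrightarrow> m \<noteq> l \<Longrightarrow> c m \<bullet> y \<le> b m" "b l < c l \<bullet> y"
    using irredundant_halfspace[OF min l] by blast
  obtain g where g: "0 < g" "\<And>m. m \<in> {1..L} \<Longrightarrow> g \<le> b m"
    using finite_positive_lower_bound[of "b ` {1..L}"] c by (metis finite_atLeastAtMost finite_imageI imageI)
  \<comment> \<open>The scaling gives \<open>z\<close> the norm \<open>g / 2\<close>, which is less than every \<open>b m\<close>.\<close>
  define z :: "real ^ 'a" where "z = (g / 2 / norm (1 :: real ^ 'a)) *\<^sub>R 1"
  have n1: "0 < norm (1 :: real ^ 'a)" by simp
  have z0: "0 < z $ i" for i using g n1 unfolding z_def by simp
  have zb: "c m \<bullet> z < b m" if "m \<in> {1..L}" for m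
  proof -
    have "c m \<bullet> z \<le> norm z" using c[OF that] norm_cauchy_schwarz[of "c m" z] by simp
    also have "norm z = g / 2" using n1 g by (simp add: z_def)
    finally show ?thesis using g(1) g(2)[OF that] by linarith
  qed
  \<comment> \<open>The parameter at which the segment from \<open>z\<close> to \<open>y\<close> crosses the hyperplane.\<close>
  define \<theta> where "\<theta> = (b l - c l \<bullet> z) / (c l \<bullet> y - c l \<bullet> z)"
  have \<theta>: "0 < \<theta>" "\<theta> < 1" using zb[OF l] y(3) by (auto simp: \<theta>_def)
  define w where "w = z + \<theta> *\<^sub>R (y - z)"
  have cw: "c m \<bullet> w = (1 - \<theta>) * (c m \<bullet> z) + \<theta> * (c m \<bullet> y)" for m
    by (simp add: w_def inner_add_right inner_diff_right algebra_simps)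
  have wl: "c l \<bullet> w = b l"
    using zb[OF l] y(3) by (simp add: w_def inner_add_right inner_diff_right \<theta>_def)
  have wm: "c m \<bullet> w < b m" if "m \<in> {1..L} - {l}" for m
  proof -
    have "(1 - \<theta>) * (c m \<bullet> z) < (1 - \<theta>) * b m" using zb[of m] that \<theta> by simp
    moreover have "\<theta> * (c m \<bullet> y) \<le> \<theta> * b m" using y(2)[of m] that \<theta> by simp
    ultimately show ?thesis unfolding cw by (simp add: algebra_simps)
  qed
  have w0: "0 < w $ i" for i
  proof -
    have "w $ i = (1 - \<theta>) * z $ i + \<theta> * y $ i" by (simp add: w_def algebra_simps)
    moreover have "0 < (1 - \<theta>) * z $ i" using \<theta> z0 by simp
    moreover have "0 \<le> \<theta> * y $ i" using \<theta> y(1) by (simp add: less_eq_vec_def)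
    ultimately show ?thesis by linarith
  qed
  define O' where "O' = (\<Inter>i. {x. 0 < x $ i}) \<inter> (\<Inter>m\<in>{1..L} - {l}. {x. c m \<bullet> x < b m})"
  have "open O'"
    unfolding O'_def
    by (intro open_Int open_INT ballI open_halfspace_lt open_Collect_less continuous_intros) auto
  moreover have "w \<in> O'" using w0 wm by (auto simp: O'_def)
  ultimately obtain \<rho> where \<rho>: "0 < \<rho>" "ball w \<rho> \<subseteq> O'"
    by (meson open_contains_ball)
  have in_facet: "x \<in> facet C (c l) (b l)" if "c l \<bullet> x = b l" "dist w x < \<rho>" for x
  proof -
    have "x \<in> O'" using that \<rho> by auto
    then have "0 \<le> x" "c m \<bullet> x \<le> b m" if "m \<in> {1..L}" for m
      using that \<open>c l \<bullet> x = b l\<close> by (auto simp: O'_def less_eq_vec_def less_imp_le intro: less_imp_le)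
    then show ?thesis using that l by (auto simp: facet_def C)
  qed
  show thesis by (rule that[OF \<rho>(1) in_facet in_facet[OF wl]]) (use \<rho> in auto)
qed

text \<open>By full dimension the affine hull of the facet is its whole hyperplane, so that the relative
  interior is the interior in the hyperplane.\<close>
lemma facet_interior_point:
  assumes min: "minimal_halfspace_description C L c b" and l: "l \<in> {1..L}"
    and r: "r \<in> rel_interior (facet C (c l) (b l))"
  obtains \<delta> where "0 < \<delta>" "\<And>v. c l \<bullet> v = 0 \<Longrightarrow> norm v \<le> \<delta> \<Longrightarrow> r + v \<in> C"
proof -
  let ?F = "facet C (c l) (b l)"
  obtain w \<rho> where w: "0 < \<rho>" "\<And>x. c l \<bullet> x = b l \<Longrightarrow> dist w x < \<rho> \<Longrightarrow> x \<in> ?F" "w \<in> ?F"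
    using facet_has_full_dimension[OF min l] by metis
  have hull: "r + v \<in> affine hull ?F" if v: "c l \<bullet> v = 0" for v
  proof -
  \<comment> \<open>\<open>h\<close> is small enough for \<open>w + h *\<^sub>R v\<close> to lie in the facet; \<open>r + v\<close> is then an affine
    combination of \<open>r\<close>, \<open>w\<close> and \<open>w + h *\<^sub>R v\<close>.\<close>
    define h where "h = \<rho> / 2 / (norm v + 1)"
    have h: "0 < h" using w(1) by (simp add: h_def add_nonneg_pos)
    have "h * norm v \<le> \<rho> / 2"
    proof -
      have "norm v / (norm v + 1) \<le> 1"
        by (rule pos_divide_le_eq[THEN iffD2]) (auto intro: add_nonneg_pos)
      then have "\<rho> / 2 * (norm v / (norm v + 1)) \<le> \<rho> / 2 * 1"
        using w(1) by (intro mult_left_mono) auto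
      then show ?thesis by (simp add: h_def)
    qed
    then have "dist w (w + h *\<^sub>R v) < \<rho>" using w(1) h by (simp add: dist_norm)
    moreover have "c l \<bullet> (w + h *\<^sub>R v) = b l"
      using w(3) v by (simp add: inner_add_right facet_def)
    ultimately have wv: "w + h *\<^sub>R v \<in> ?F" using w(2) by blast
    have "1 *\<^sub>R r + (1 / h) *\<^sub>R (w + h *\<^sub>R v) + (- 1 / h) *\<^sub>R w \<in> affine hull ?F"
      using wv w(3) r rel_interior_subset[of ?F]
      by (intro mem_affine_3 affine_affine_hull hull_inc) auto
    moreover have "1 *\<^sub>R r + (1 / h) *\<^sub>R (w + h *\<^sub>R v) + (- 1 / h) *\<^sub>R w = r + v"
      using h by (simp add: algebra_simps)
    ultimately show ?thesis by (simp only:)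
  qed
  obtain \<delta> where \<delta>: "0 < \<delta>" "cball r \<delta> \<inter> affine hull ?F \<subseteq> ?F"
    using r by (auto simp: mem_rel_interior_cball)
  show thesis
  proof (rule that[OF \<delta>(1)])
    fix v assume v: "c l \<bullet> v = 0" "norm v \<le> \<delta>"
    have "r + v \<in> cball r \<delta> \<inter> affine hull ?F" using v hull[OF v(1)] by (simp add: dist_norm)
    then show "r + v \<in> C" using \<delta>(2) by (auto simp: facet_def)
  qed
qed

context service_structure
begin

lemma services_bounded:
  obtains K where "\<And>t s. t \<in> \<T> \<Longrightarrow> s \<in> S t \<Longrightarrow> norm s \<le> K"
proof -
  have "finite (\<Union>t\<in>\<T>. S t)" using finite_channels finite_services by auto
  then have "bounded (\<Union>t\<in>\<T>. S t)" by (rule finite_imp_bounded)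
  then show thesis using that unfolding bounded_iff by blast
qed

lemma max_service_ge: "t \<in> \<T> \<Longrightarrow> s \<in> S t \<Longrightarrow> x \<bullet> s \<le> max_service S x t"
  unfolding max_service_def using finite_services by (intro Max_ge) auto

lemma max_service_attained:
  assumes "t \<in> \<T>"
  obtains s where "s \<in> S t" "x \<bullet> s = max_service S x t"
proof -
  have "max_service S x t \<in> (\<lambda>s. x \<bullet> s) ` S t"
    unfolding max_service_def using assms finite_services services_nonempty by (intro Max_in) auto
  then show thesis using that by force
qed

lemma inner_capacity_le:
  assumes "z \<in> capacity_region \<T> S \<psi>"
  shows "x \<bullet> z \<le> (\<Sum>t\<in>\<T>. pmf \<psi> t * max_service S x t)"
proof -
  obtain y where y: "\<And>t. t \<in> \<T> \<Longrightarrow> y t \<in> convex hull (S t)" and z: "z = (\<Sum>t\<in>\<T>. pmf \<psi> t *\<^sub>R y t)"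
    using assms by (auto simp: capacity_region_def)
  have "x \<bullet> y t \<le> max_service S x t" if t: "t \<in> \<T>" for t
  proof -
    have "convex hull (S t) \<subseteq> {s. x \<bullet> s \<le> max_service S x t}"
      using max_service_ge[OF t] by (intro hull_minimal convex_halfspace_le) auto
    then show ?thesis using y[OF t] by auto
  qed
  then show ?thesis
    unfolding z inner_sum_right inner_scaleR_right by (intro sum_mono mult_left_mono) auto
qed

text \<open>The maximum of a linear functional over the capacity region is the mean over the channel states of
  the maxima that MaxWeight attains.\<close>
lemma max_service_sum_attained:
  obtains z where "z \<in> capacity_region \<T> S \<psi>" "x \<bullet> z = (\<Sum>t\<in>\<T>. pmf \<psi> t * max_service S x t)"
proof -
  have "\<forall>t\<in>\<T>. \<exists>s. s \<in> S t \<and> x \<bullet> s = max_service S x t" using max_service_attained by metis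
  then obtain s where s: "\<forall>t\<in>\<T>. s t \<in> S t \<and> x \<bullet> s t = max_service S x t" by metis
  show thesis
  proof (rule that)
    show "(\<Sum>t\<in>\<T>. pmf \<psi> t *\<^sub>R s t) \<in> capacity_region \<T> S \<psi>"
      unfolding capacity_region_def using s by (auto intro!: exI[of _ s] hull_inc)
    show "x \<bullet> (\<Sum>t\<in>\<T>. pmf \<psi> t *\<^sub>R s t) = (\<Sum>t\<in>\<T>. pmf \<psi> t * max_service S x t)"
      unfolding inner_sum_right using s by (intro sum.cong) auto
  qed
qed

text \<open>There are finitely many services, so one that is not optimal in direction \<open>c\<close> falls short of the
  optimum by at least some \<open>g > 0\<close>. If \<open>s\<close> is nevertheless optimal for \<open>x\<close>, comparing it with an
  optimal \<open>s'\<close> for \<open>c\<close> bounds \<open>(c \<bullet> x) * g\<close> by \<open>perp c x \<bullet> (s - s')\<close>.\<close>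
lemma alignment_constant:
  assumes c: "norm c = 1" "0 \<le> c"
  obtains \<kappa> where "0 \<le> \<kappa>" "\<And>i. c $ i = 0 \<or> 1 \<le> \<kappa> * c $ i"
    "\<And>t s x. t \<in> \<T> \<Longrightarrow> s \<in> S t \<Longrightarrow> \<forall>s'\<in>S t. x \<bullet> s' \<le> x \<bullet> s \<Longrightarrow>
       (c \<bullet> x) * (max_service S c t - c \<bullet> s) \<le> \<kappa> * (max_service S c t - c \<bullet> s) * norm (perp c x)"
proof -
  obtain K where K: "\<And>t s. t \<in> \<T> \<Longrightarrow> s \<in> S t \<Longrightarrow> norm s \<le> K"
    using services_bounded by metis
  have "finite (\<Union>t\<in>\<T>. (\<lambda>s. max_service S c t - c \<bullet> s) ` S t)"
    using finite_channels finite_services by auto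
  then obtain g where g: "0 < g"
    "\<And>t s. t \<in> \<T> \<Longrightarrow> s \<in> S t \<Longrightarrow> 0 < max_service S c t - c \<bullet> s \<Longrightarrow> g \<le> max_service S c t - c \<bullet> s"
    by (rule finite_positive_lower_bound) blast
  obtain d where d: "0 < d" "\<And>i. 0 < c $ i \<Longrightarrow> d \<le> c $ i"
    by (rule finite_positive_lower_bound[of "range (\<lambda>i. c $ i)"]) auto
  \<comment> \<open>The first summand serves the components of \<open>c\<close>, the second one the gap \<open>g\<close> in the services.\<close>
  define \<kappa> where "\<kappa> = 1 / d + 2 * \<bar>K\<bar> / g"
  show thesis
  proof (rule that[of \<kappa>])
    show "0 \<le> \<kappa>" using g d by (simp add: \<kappa>_def)
    show "c $ i = 0 \<or> 1 \<le> \<kappa> * c $ i" for i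
    proof (cases "c $ i = 0")
      case False
      then have "0 < c $ i" using c(2) by (simp add: less_eq_vec_def less_le)
      then have "1 \<le> 1 / d * c $ i" using d by (simp add: field_simps)
      also have "\<dots> \<le> \<kappa> * c $ i"
        unfolding \<kappa>_def using g \<open>0 < c $ i\<close> by (intro mult_right_mono) auto
      finally show ?thesis by simp
    qed simp
  next
    fix t s x assume t: "t \<in> \<T>" and s: "s \<in> S t" and max: "\<forall>s'\<in>S t. x \<bullet> s' \<le> x \<bullet> s"
    obtain s' where s': "s' \<in> S t" "c \<bullet> s' = max_service S c t" using max_service_attained[OF t] by blast
    let ?g = "max_service S c t - c \<bullet> s"
    show "(c \<bullet> x) * ?g \<le> \<kappa> * ?g * norm (perp c x)"
    proof (cases "?g = 0")
      case False
      then have gap: "g \<le> ?g" using g(2)[OF t s] max_service_ge[OF t s, of c] by simp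
      have "(c \<bullet> x) * ?g = perp c x \<bullet> (s - s') + (x \<bullet> s' - x \<bullet> s)"
        using s' by (simp add: inner_perp inner_diff_right algebra_simps)
      also have "\<dots> \<le> norm (perp c x) * norm (s - s')"
        using bspec[OF max s'(1)] norm_cauchy_schwarz[of "perp c x" "s - s'"] by linarith
      also have "\<dots> \<le> norm (perp c x) * (2 * \<bar>K\<bar>)"
        using norm_triangle_ineq4[of s s'] K[OF t s] K[OF t s'(1)] by (intro mult_left_mono) auto
      also have "\<dots> \<le> norm (perp c x) * (2 * \<bar>K\<bar> / g * ?g)"
      proof (rule mult_left_mono)
        have "2 * \<bar>K\<bar> * 1 \<le> 2 * \<bar>K\<bar> * (?g / g)" using gap g(1) by (intro mult_left_mono) auto
        then show "2 * \<bar>K\<bar> \<le> 2 * \<bar>K\<bar> / g * ?g" by simp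
      qed simp
      also have "\<dots> \<le> norm (perp c x) * (\<kappa> * ?g)"
        unfolding \<kappa>_def using gap g d by (intro mult_left_mono mult_right_mono) auto
      finally show ?thesis by (simp add: mult_ac)
    qed simp
  qed
qed

end

section \<open>Limits of transforms and collapse onto a line\<close>

text \<open>The density times \<open>iexp (t * x)\<close> is \<open>exp (z * x) / m\<close> with \<open>z = \<i> * t - 1 / m\<close>, whose
  antiderivative vanishes at infinity.\<close>
lemma char_exponential_law:
  assumes "0 \<le> m"
  shows "char (exponential_law m) t = 1 / (1 - \<i> * of_real (t * m))"
proof (cases "m = 0")
  case True
  then show ?thesis by (simp add: exponential_law_def char_def integral_return)
next
  case False
  with assms have m: "0 < m" by simp
  define z where "z = \<i> * of_real t - of_real (1 / m)"
  have z0: "z \<noteq> 0" using m by (auto simp: z_def complex_eq_iff)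
  have nz: "norm (exp (z * of_real x)) = exp (- x / m)" for x
    by (simp add: z_def)
  have D: "((\<lambda>x. exp (z * of_real x) / z) has_vector_derivative exp (z * of_real x)) (at x)" for x :: real
    using z0 by (auto intro!: derivative_eq_intros has_vector_derivative_real_field simp: field_simps)
  have E: "integrable lborel (\<lambda>x. m * exponential_density (1 / m) x)"
  proof -
    interpret prob_space "density lborel (exponential_density (1 / m))"
      using m by (intro prob_space_exponential_density) simp
    have "integrable (density lborel (exponential_density (1 / m))) (\<lambda>x. m :: real)" by simp
    then show ?thesis
      using m by (subst (asm) integrable_density) (auto simp: exponential_density_nonneg mult.commute)
  qed
  have I: "set_integrable lborel {0<..} (\<lambda>x. exp (z * of_real x))"
    unfolding set_integrable_def
    by (rule Bochner_Integration.integrable_bound[OF E])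
       (use m in \<open>auto simp: z_def exponential_density_def split: split_indicator\<close>)
  have "(LBINT x=0..\<infinity>. exp (z * of_real x)) = 0 - 1 / z"
  proof (rule interval_integral_FTC_integrable[where F = "\<lambda>x. exp (z * of_real x) / z"])
    have "((\<lambda>x. exp (z * complex_of_real x) / z) \<longlongrightarrow> 0) at_top"
    proof (rule tendsto_norm_zero_cancel)
      have "((\<lambda>x. exp (- x / m) / norm z) \<longlongrightarrow> 0) at_top"
        by (intro tendsto_divide_zero) (use m in real_asymp)
      then show "((\<lambda>x. norm (exp (z * complex_of_real x) / z)) \<longlongrightarrow> 0) at_top"
        by (simp only: nz norm_divide)
    qed
    then show "(((\<lambda>x. exp (z * complex_of_real x) / z) \<circ> real_of_ereal) \<longlongrightarrow> 0) (at_left \<infinity>)"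
      by (simp add: ereal_tendsto_simps)
    have "((\<lambda>x. exp (z * complex_of_real x) / z) \<longlongrightarrow> exp (z * complex_of_real 0) / z) (at_right 0)"
      by (intro tendsto_intros) (use z0 in auto)
    then show "(((\<lambda>x. exp (z * complex_of_real x) / z) \<circ> real_of_ereal) \<longlongrightarrow> 1 / z) (at_right 0)"
      by (simp add: ereal_tendsto_simps zero_ereal_def)
  qed (use D I in \<open>auto simp: zero_ereal_def\<close>)
  then have *: "(LINT x:{0<..}|lborel. exp (z * of_real x)) = - 1 / z"
    by (simp add: interval_lebesgue_integral_def zero_ereal_def)
  have "char (exponential_law m) t = (LINT x|lborel. exponential_density (1 / m) x *\<^sub>R iexp (t * x))"
    using m by (simp add: exponential_law_def char_def integral_density exponential_density_nonneg)
  also have "\<dots> = (LINT x|lborel. (1 / m) *\<^sub>R (indicator {0<..} x *\<^sub>R exp (z * of_real x)))"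
  proof (rule integral_cong_AE)
    have "AE x in lborel. x \<noteq> (0::real)" by (rule AE_lborel_singleton)
    then show "AE x in lborel. exponential_density (1 / m) x *\<^sub>R iexp (t * x)
        = (1 / m) *\<^sub>R (indicator {0<..} x *\<^sub>R exp (z * of_real x))"
    proof eventually_elim
      case (elim x)
      have "exp (z * of_real x) = exp (of_real (- x / m)) * iexp (t * x)"
        unfolding z_def exp_add[symmetric] by (simp add: algebra_simps)
      then have "exp (z * of_real x) = of_real (exp (- x / m)) * iexp (t * x)"
        by (simp only: exp_of_real)
      then show ?case using elim
        by (auto simp: exponential_density_def scaleR_conv_of_real split: split_indicator)
    qed
  qed measurable
  also have "\<dots> = (1 / m) *\<^sub>R (- 1 / z)"
    using * unfolding set_lebesgue_integral_def by (simp only: integral_scaleR_right)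
  also have "\<dots> = 1 / (1 - \<i> * of_real (t * m))"
  proof -
    have "of_real m * (- z) = 1 - \<i> * of_real (t * m)"
      using m by (simp add: z_def algebra_simps)
    moreover have "(1 / m) *\<^sub>R (- 1 / z) = 1 / (of_real m * (- z))"
      by (simp add: scaleR_conv_of_real)
    ultimately show ?thesis by (simp only:)
  qed
  finally show ?thesis .
qed

lemma exponential_law_real_distribution:
  assumes "0 \<le> m"
  shows "real_distribution (exponential_law m)"
proof (cases "m = 0")
  case True
  have "prob_space (return borel (0 :: real))" by (rule prob_space_return) simp
  then show ?thesis
    by (simp add: True exponential_law_def real_distribution_def real_distribution_axioms_def)
next
  case False
  then have "prob_space (density lborel (exponential_density (1 / m)))"
    using assms by (intro prob_space_exponential_density) simp
  then show ?thesis
    using False assms by (simp add: exponential_law_def real_distribution_def real_distribution_axioms_def)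
qed

lemma levy_continuity_at_right:
  fixes \<nu> :: "real \<Rightarrow> real measure" and f :: "real \<Rightarrow> real"
  assumes \<nu>: "\<And>\<epsilon>. 0 < \<epsilon> \<Longrightarrow> \<epsilon> < 1 \<Longrightarrow> real_distribution (\<nu> \<epsilon>)" and \<nu>': "real_distribution \<nu>'"
    and char: "\<And>t. ((\<lambda>\<epsilon>. char (\<nu> \<epsilon>) t) \<longlongrightarrow> char \<nu>' t) (at_right 0)"
    and f: "continuous_on UNIV f" "\<And>x. \<bar>f x\<bar> \<le> Bd"
  shows "((\<lambda>\<epsilon>. \<integral>x. f x \<partial>\<nu> \<epsilon>) \<longlongrightarrow> (\<integral>x. f x \<partial>\<nu>')) (at_right 0)"
proof -
  have at: "at_right 0 = at (0::real) within {0<..<1}"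
    by (rule at_within_nhd[of _ "{..<1}"]) auto
  show ?thesis
    unfolding at tendsto_at_iff_sequentially
  proof (intro allI impI)
    fix X :: "nat \<Rightarrow> real"
    assume X: "\<forall>i. X i \<in> {0<..<1} - {0}" "X \<longlonglongrightarrow> 0"
    have d: "real_distribution (\<nu> (X n))" for n using X(1) by (intro \<nu>) auto
    have "(\<lambda>n. char (\<nu> (X n)) t) \<longlonglongrightarrow> char \<nu>' t" for t
      using char[of t] X unfolding at tendsto_at_iff_sequentially by (auto simp: o_def)
    then have "weak_conv_m (\<lambda>n. \<nu> (X n)) \<nu>'"
      by (intro levy_continuity d \<nu>')
    then have "(\<lambda>n. \<integral>x. f x \<partial>\<nu> (X n)) \<longlonglongrightarrow> (\<integral>x. f x \<partial>\<nu>')"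
      using f d \<nu>' by (intro weak_conv_imp_integral_bdd_continuous_conv[where B = Bd])
        (auto simp: continuous_on_eq_continuous_at)
    then show "((\<lambda>\<epsilon>. \<integral>x. f x \<partial>\<nu> \<epsilon>) \<circ> X) \<longlonglongrightarrow> (\<integral>x. f x \<partial>\<nu>')"
      by (simp add: o_def)
  qed
qed

text \<open>The factor \<open>\<i> * \<theta> + \<theta>\<^sup>2 * \<sigma> \<epsilon> / 2\<close> has imaginary part \<open>\<theta>\<close> and can be divided out.\<close>
lemma transform_limit:
  fixes \<Phi> :: "'i \<Rightarrow> complex" and \<sigma> :: "'i \<Rightarrow> real"
  assumes err: "((\<lambda>\<epsilon>. \<Phi> \<epsilon> * (\<i> * \<theta> + \<theta>\<^sup>2 * \<sigma> \<epsilon> / 2) - \<i> * \<theta>) \<longlongrightarrow> 0) F"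
    and \<sigma>: "(\<sigma> \<longlongrightarrow> 2 * m) F" and \<theta>: "\<theta> \<noteq> (0::real)"
  shows "(\<Phi> \<longlongrightarrow> 1 / (1 - \<i> * of_real (\<theta> * m))) F"
proof -
  let ?D = "\<lambda>\<epsilon>. \<i> * \<theta> + complex_of_real (\<theta>\<^sup>2 * \<sigma> \<epsilon> / 2)"
  have D: "((\<lambda>\<epsilon>. ?D \<epsilon>) \<longlongrightarrow> \<i> * \<theta> + complex_of_real (\<theta>\<^sup>2 * (2 * m) / 2)) F"
    by (intro tendsto_intros \<sigma>) simp
  have nz: "\<i> * \<theta> + complex_of_real x \<noteq> 0" for x
    using \<theta> by (simp add: complex_eq_iff)
  have "((\<lambda>\<epsilon>. ((\<Phi> \<epsilon> * ?D \<epsilon> - \<i> * \<theta>) + \<i> * \<theta>) / ?D \<epsilon>)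
      \<longlongrightarrow> (0 + \<i> * \<theta>) / (\<i> * \<theta> + complex_of_real (\<theta>\<^sup>2 * (2 * m) / 2))) F"
    by (intro tendsto_divide tendsto_add err tendsto_const D nz)
  moreover have "((\<Phi> \<epsilon> * ?D \<epsilon> - \<i> * \<theta>) + \<i> * \<theta>) / ?D \<epsilon> = \<Phi> \<epsilon>" for \<epsilon>
    using nonzero_mult_div_cancel_right[OF nz[of "\<theta>\<^sup>2 * \<sigma> \<epsilon> / 2"], of "\<Phi> \<epsilon>"] by (simp only: diff_add_cancel)
  moreover have "(0 + \<i> * \<theta>) / (\<i> * \<theta> + complex_of_real (\<theta>\<^sup>2 * (2 * m) / 2)) = 1 / (1 - \<i> * of_real (\<theta> * m))"
  proof -
    have "\<i> * \<theta> + complex_of_real (\<theta>\<^sup>2 * (2 * m) / 2) = (\<i> * \<theta>) * (1 - \<i> * of_real (\<theta> * m))"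
      by (simp add: power2_eq_square algebra_simps)
    then show ?thesis using \<theta> by simp
  qed
  ultimately show ?thesis by simp
qed

text \<open>The bound on the component along \<open>c\<close> gives tightness, so \<open>f\<close> may be treated as uniformly
  continuous; the scaled orthogonal component \<open>\<epsilon> *\<^sub>R perp c x\<close> vanishes in mean.\<close>
lemma collapse_onto_line:
  fixes f :: "'a::euclidean_space \<Rightarrow> real" and \<mu> :: "real \<Rightarrow> 'a measure"
  assumes f: "continuous_on UNIV f" "\<And>x. \<bar>f x\<bar> \<le> Bd" and c: "norm c = 1"
    and \<mu>: "\<And>\<epsilon>. 0 < \<epsilon> \<Longrightarrow> \<epsilon> < 1 \<Longrightarrow> prob_space (\<mu> \<epsilon>) \<and> sets (\<mu> \<epsilon>) = sets borel"
    and along: "\<And>\<epsilon>. 0 < \<epsilon> \<Longrightarrow> \<epsilon> < 1 \<Longrightarrow>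
      integrable (\<mu> \<epsilon>) (\<lambda>x. \<bar>c \<bullet> x\<bar>) \<and> \<epsilon> * (\<integral>x. \<bar>c \<bullet> x\<bar> \<partial>\<mu> \<epsilon>) \<le> D1"
    and across: "\<And>\<epsilon>. 0 < \<epsilon> \<Longrightarrow> \<epsilon> < 1 \<Longrightarrow>
      integrable (\<mu> \<epsilon>) (\<lambda>x. norm (perp c x)) \<and> (\<integral>x. norm (perp c x) \<partial>\<mu> \<epsilon>) \<le> D2"
  shows "((\<lambda>\<epsilon>. (\<integral>x. f (\<epsilon> *\<^sub>R x) \<partial>\<mu> \<epsilon>) - (\<integral>x. f ((\<epsilon> * (c \<bullet> x)) *\<^sub>R c) \<partial>\<mu> \<epsilon>)) \<longlongrightarrow> 0) (at_right 0)"
proof (rule tendstoI)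
  fix e :: real assume e: "0 < e"
  have Bd: "0 \<le> Bd" using f(2)[of 0] by linarith
  have D1: "0 \<le> D1"
  proof -
    have "1/2 * (\<integral>x. \<bar>c \<bullet> x\<bar> \<partial>\<mu> (1/2)) \<le> D1" by (rule along[THEN conjunct2]) auto
    moreover have "0 \<le> 1/2 * (\<integral>x. \<bar>c \<bullet> x\<bar> \<partial>\<mu> (1/2))" by simp
    ultimately show ?thesis by linarith
  qed
  have D2: "0 \<le> D2"
  proof -
    have "(\<integral>x. norm (perp c x) \<partial>\<mu> (1/2)) \<le> D2" by (rule across[THEN conjunct2]) auto
    moreover have "0 \<le> (\<integral>x. norm (perp c x) \<partial>\<mu> (1/2))" by simp
    ultimately show ?thesis by linarith
  qed
  \<comment> \<open>By Markov's inequality \<open>\<epsilon> * \<bar>c \<bullet> x\<bar>\<close> exceeds \<open>R\<close> with probability at most \<open>D1 / R\<close>; the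
    summand \<open>1\<close> keeps \<open>R\<close> positive.\<close>
  define R where "R = 8 * Bd * D1 / e + 1"
  have R: "0 < R" "2 * Bd / R * D1 \<le> e / 4"
  proof -
    show "0 < R" using Bd D1 e by (simp add: R_def add_nonneg_pos)
    have "8 * Bd * D1 / e \<le> R" unfolding R_def by simp
    then show "2 * Bd / R * D1 \<le> e / 4" using \<open>0 < R\<close> e by (simp add: field_simps)
  qed
  have "uniformly_continuous_on (cball 0 (R + 1)) f"
    using f(1) by (intro compact_uniformly_continuous) (auto intro: continuous_on_subset)
  then obtain d where d: "0 < d"
    "\<And>x y. x \<in> cball 0 (R + 1) \<Longrightarrow> y \<in> cball 0 (R + 1) \<Longrightarrow> dist x y < d \<Longrightarrow> dist (f x) (f y) < e / 4"
    unfolding uniformly_continuous_on_def using e by (metis divide_pos_pos zero_less_numeral dist_commute)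
  define \<rho> where "\<rho> = min (d / 2) 1"
  have \<rho>: "0 < \<rho>" "\<rho> < d" "\<rho> \<le> 1" using d(1) by (auto simp: \<rho>_def)
  have bound: "\<bar>f (\<epsilon> *\<^sub>R x) - f ((\<epsilon> * (c \<bullet> x)) *\<^sub>R c)\<bar>
      \<le> e / 4 + 2 * Bd / R * (\<epsilon> * \<bar>c \<bullet> x\<bar>) + 2 * Bd / \<rho> * (\<epsilon> * norm (perp c x))"
    if \<epsilon>: "0 < \<epsilon>" for \<epsilon> x
  proof -
    have nn: "0 \<le> 2 * Bd / R * (\<epsilon> * \<bar>c \<bullet> x\<bar>)" "0 \<le> 2 * Bd / \<rho> * (\<epsilon> * norm (perp c x))"
      using \<epsilon> Bd R \<rho> by auto
    have diff: "\<epsilon> *\<^sub>R x - (\<epsilon> * (c \<bullet> x)) *\<^sub>R c = \<epsilon> *\<^sub>R perp c x"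
      by (simp add: perp_def algebra_simps)
    have B2: "\<bar>f (\<epsilon> *\<^sub>R x) - f ((\<epsilon> * (c \<bullet> x)) *\<^sub>R c)\<bar> \<le> 2 * Bd"
      using f(2)[of "\<epsilon> *\<^sub>R x"] f(2)[of "(\<epsilon> * (c \<bullet> x)) *\<^sub>R c"] by linarith
    consider "\<epsilon> * \<bar>c \<bullet> x\<bar> \<ge> R" | "\<epsilon> * norm (perp c x) \<ge> \<rho>"
      | "\<epsilon> * \<bar>c \<bullet> x\<bar> < R" "\<epsilon> * norm (perp c x) < \<rho>" by linarith
    then show ?thesis
    proof cases
      case 1
      then have "2 * Bd / R * R \<le> 2 * Bd / R * (\<epsilon> * \<bar>c \<bullet> x\<bar>)" using Bd R by (intro mult_left_mono) auto
      then show ?thesis using B2 nn R e by simp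
    next
      case 2
      then have "2 * Bd / \<rho> * \<rho> \<le> 2 * Bd / \<rho> * (\<epsilon> * norm (perp c x))" using Bd \<rho> by (intro mult_left_mono) auto
      then show ?thesis using B2 nn \<rho> e by simp
    next
      case 3
      have n1: "norm ((\<epsilon> * (c \<bullet> x)) *\<^sub>R c) < R" using 3 \<epsilon> c by (simp add: abs_mult)
      moreover have n2: "norm (\<epsilon> *\<^sub>R x - (\<epsilon> * (c \<bullet> x)) *\<^sub>R c) < \<rho>" using 3 \<epsilon> unfolding diff by simp
      ultimately have "norm (\<epsilon> *\<^sub>R x) < R + 1"
        using norm_triangle_sub[of "\<epsilon> *\<^sub>R x" "(\<epsilon> * (c \<bullet> x)) *\<^sub>R c"] \<rho> by linarith
      then have "dist (f (\<epsilon> *\<^sub>R x)) (f ((\<epsilon> * (c \<bullet> x)) *\<^sub>R c)) < e / 4"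
        using n1 n2 \<rho> by (intro d(2)) (auto simp: dist_norm)
      then show ?thesis using nn by (simp add: dist_real_def)
    qed
  qed
  define \<epsilon>0 where "\<epsilon>0 = min 1 (e / 4 / (2 * Bd / \<rho> * D2 + 1))"
  have pos: "0 < 2 * Bd / \<rho> * D2 + 1" using Bd D2 \<rho> by (simp add: add_nonneg_pos)
  then have \<epsilon>0: "0 < \<epsilon>0" using e by (simp add: \<epsilon>0_def)
  have "dist ((\<integral>x. f (\<epsilon> *\<^sub>R x) \<partial>\<mu> \<epsilon>) - (\<integral>x. f ((\<epsilon> * (c \<bullet> x)) *\<^sub>R c) \<partial>\<mu> \<epsilon>)) 0 < e"
    if \<epsilon>: "0 < \<epsilon>" "\<epsilon> < \<epsilon>0" for \<epsilon>
  proof -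
    have \<epsilon>1: "\<epsilon> < 1" using \<epsilon> by (simp add: \<epsilon>0_def)
    interpret prob_space "\<mu> \<epsilon>" using \<mu> \<epsilon> \<epsilon>1 by auto
    have [measurable_cong]: "sets (\<mu> \<epsilon>) = sets borel" using \<mu> \<epsilon> \<epsilon>1 by auto
    have [measurable]: "f \<in> borel_measurable borel" using f(1) by (rule borel_measurable_continuous_onI)
    have i1: "integrable (\<mu> \<epsilon>) (\<lambda>x. f (\<epsilon> *\<^sub>R x))"
      using f(2) by (intro integrable_const_bound[of _ Bd]) auto
    have i2: "integrable (\<mu> \<epsilon>) (\<lambda>x. f ((\<epsilon> * (c \<bullet> x)) *\<^sub>R c))"
      using f(2) by (intro integrable_const_bound[of _ Bd]) auto
    note a = along[OF \<epsilon>(1) \<epsilon>1] and p = across[OF \<epsilon>(1) \<epsilon>1]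
    have i3: "integrable (\<mu> \<epsilon>) (\<lambda>x. e / 4 + 2 * Bd / R * (\<epsilon> * \<bar>c \<bullet> x\<bar>) + 2 * Bd / \<rho> * (\<epsilon> * norm (perp c x)))"
      using a p by auto
    have "\<bar>(\<integral>x. f (\<epsilon> *\<^sub>R x) \<partial>\<mu> \<epsilon>) - (\<integral>x. f ((\<epsilon> * (c \<bullet> x)) *\<^sub>R c) \<partial>\<mu> \<epsilon>)\<bar>
      = \<bar>\<integral>x. f (\<epsilon> *\<^sub>R x) - f ((\<epsilon> * (c \<bullet> x)) *\<^sub>R c) \<partial>\<mu> \<epsilon>\<bar>"
      using i1 i2 by simp
    also have "\<dots> \<le> (\<integral>x. \<bar>f (\<epsilon> *\<^sub>R x) - f ((\<epsilon> * (c \<bullet> x)) *\<^sub>R c)\<bar> \<partial>\<mu> \<epsilon>)"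
      by (rule integral_abs_bound)
    also have "\<dots> \<le> (\<integral>x. e / 4 + 2 * Bd / R * (\<epsilon> * \<bar>c \<bullet> x\<bar>) + 2 * Bd / \<rho> * (\<epsilon> * norm (perp c x)) \<partial>\<mu> \<epsilon>)"
      using i1 i2 i3 bound[OF \<epsilon>(1)] by (intro integral_mono) auto
    also have "\<dots> = e / 4 + 2 * Bd / R * (\<epsilon> * (\<integral>x. \<bar>c \<bullet> x\<bar> \<partial>\<mu> \<epsilon>)) + 2 * Bd / \<rho> * (\<epsilon> * (\<integral>x. norm (perp c x) \<partial>\<mu> \<epsilon>))"
      using a p prob_space by simp
    also have "2 * Bd / R * (\<epsilon> * (\<integral>x. \<bar>c \<bullet> x\<bar> \<partial>\<mu> \<epsilon>)) \<le> 2 * Bd / R * D1"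
      using a Bd R by (intro mult_left_mono) auto
    also have "2 * Bd / R * D1 \<le> e / 4" by (rule R)
    also have "2 * Bd / \<rho> * (\<epsilon> * (\<integral>x. norm (perp c x) \<partial>\<mu> \<epsilon>)) \<le> 2 * Bd / \<rho> * (\<epsilon> * D2)"
      using p Bd \<rho> \<epsilon> by (intro mult_left_mono) auto
    also have "2 * Bd / \<rho> * (\<epsilon> * D2) \<le> e / 4"
    proof -
      have "\<epsilon> < e / 4 / (2 * Bd / \<rho> * D2 + 1)" using \<epsilon>(2) by (simp add: \<epsilon>0_def)
      then have "\<epsilon> * (2 * Bd / \<rho> * D2 + 1) < e / 4" by (simp only: pos_less_divide_eq[OF pos])
      then show ?thesis using \<epsilon>(1) by (simp add: algebra_simps)
    qed
    finally show ?thesis using e by (simp add: dist_real_def)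
  qed
  then show "\<forall>\<^sub>F \<epsilon> in at_right 0. dist ((\<integral>x. f (\<epsilon> *\<^sub>R x) \<partial>\<mu> \<epsilon>) - (\<integral>x. f ((\<epsilon> * (c \<bullet> x)) *\<^sub>R c) \<partial>\<mu> \<epsilon>)) 0 < e"
    using eventually_at_right_field \<epsilon>0 by (auto simp: eventually_at_right_field)
qed

section \<open>One slot of the MaxWeight switch\<close>

context maxweight_switch
begin

context
  \<comment> \<open>Here \<open>1\<close> is the number of the first slot and occurs as an argument of the processes.\<close>
  notes One_nat_def [simp del]
begin

definition first_service :: "real ^ 'n \<Rightarrow> 'w \<Rightarrow> real ^ 'n" where
  "first_service x \<omega> = rule (T 1 \<omega>) x (U 1 \<omega>)"

lemma first_slot_measurable [measurable]:
  "a 1 \<in> borel_measurable M" "T 1 \<in> M \<rightarrow>\<^sub>M count_space \<T>" "U 1 \<in> borel_measurable M"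
  using arrival_measurable channel_measurable tie_measurable by auto

lemma channel_in: "\<omega> \<in> space M \<Longrightarrow> T 1 \<omega> \<in> \<T>"
  using measurable_space[OF first_slot_measurable(2)] by simp

lemma channel_function_measurable [measurable]: "(\<lambda>\<omega>. f (T 1 \<omega>) :: real) \<in> borel_measurable M"
  by (rule measurable_compose[OF first_slot_measurable(2)]) simp

lemma expectation_channel:
  fixes f :: "'t \<Rightarrow> real"
  shows "integrable M (\<lambda>\<omega>. f (T 1 \<omega>))" and "(\<integral>\<omega>. f (T 1 \<omega>) \<partial>M) = (\<Sum>t\<in>\<T>. pmf \<psi> t * f t)"
proof -
  let ?g = "\<lambda>\<omega>. \<Sum>t\<in>\<T>. f t * indicator {\<omega> \<in> space M. T 1 \<omega> = t} \<omega>"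
  have set: "{\<omega> \<in> space M. T 1 \<omega> = t} \<in> sets M" if "t \<in> \<T>" for t
  proof -
    have "T 1 -` {t} \<inter> space M \<in> sets M" using that by (intro measurable_sets[OF first_slot_measurable(2)]) simp
    moreover have "T 1 -` {t} \<inter> space M = {\<omega> \<in> space M. T 1 \<omega> = t}" by auto
    ultimately show ?thesis by simp
  qed
  have eq: "f (T 1 \<omega>) = ?g \<omega>" if "\<omega> \<in> space M" for \<omega>
  proof -
    have "?g \<omega> = (\<Sum>t\<in>\<T>. if T 1 \<omega> = t then f t else 0)"
      using that by (intro sum.cong) (auto simp: indicator_def)
    then show ?thesis using channel_in[OF that] finite_channels by simp
  qed
  have int: "integrable M ?g"
    using set by (intro Bochner_Integration.integrable_sum integrable_mult_right integrable_real_indicator)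
      (auto simp: emeasure_eq_measure)
  then show "integrable M (\<lambda>\<omega>. f (T 1 \<omega>))" using eq by (subst Bochner_Integration.integrable_cong[OF refl eq])
  have "(\<integral>\<omega>. f (T 1 \<omega>) \<partial>M) = (\<integral>\<omega>. ?g \<omega> \<partial>M)"
    by (rule Bochner_Integration.integral_cong[OF refl eq])
  also have "\<dots> = (\<Sum>t\<in>\<T>. f t * prob {\<omega> \<in> space M. T 1 \<omega> = t})"
    using set by (subst Bochner_Integration.integral_sum) (auto simp: emeasure_eq_measure intro!: sum.cong)
  finally show "(\<integral>\<omega>. f (T 1 \<omega>) \<partial>M) = (\<Sum>t\<in>\<T>. pmf \<psi> t * f t)"
    using channel_law[of 1] by (simp add: mult.commute)
qed

lemma first_service_measurable: "(\<lambda>(x, \<omega>). first_service x \<omega>) \<in> borel_measurable (borel \<Otimes>\<^sub>M M)"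
proof -
  have "(\<lambda>z. (\<lambda>t z. rule t (fst z) (U 1 (snd z))) (T 1 (snd z)) z) \<in> borel_measurable (borel \<Otimes>\<^sub>M M)"
  proof (rule measurable_compose_countable'[where I = \<T>])
    fix t assume t: "t \<in> \<T>"
    have "(\<lambda>z. (\<lambda>(x, u). rule t x u) (fst z, U 1 (snd z))) \<in> borel_measurable (borel \<Otimes>\<^sub>M M)"
      by (rule measurable_compose[OF _ rule_measurable[OF t]]) measurable
    then show "(\<lambda>z. rule t (fst z) (U 1 (snd z))) \<in> borel_measurable (borel \<Otimes>\<^sub>M M)" by simp
  qed (use finite_channels in \<open>auto intro: countable_finite\<close>)
  then show ?thesis by (simp add: first_service_def case_prod_beta)
qed

lemma first_service_in: "\<omega> \<in> space M \<Longrightarrow> first_service x \<omega> \<in> S (T 1 \<omega>)"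
  and first_service_max: "\<omega> \<in> space M \<Longrightarrow> y \<in> S (T 1 \<omega>) \<Longrightarrow> x \<bullet> y \<le> x \<bullet> first_service x \<omega>"
  using maxweight[OF channel_in, of \<omega> x "U 1 \<omega>"]
  unfolding first_service_def is_arg_max_linorder by (auto simp: inner_commute)

text \<open>Although the choice of the service may depend on the tie breaking, its weight does not. Expected
  weights involve the law of the channel state alone, whatever the joint law with the tie breaking.\<close>
lemma inner_first_service: "\<omega> \<in> space M \<Longrightarrow> x \<bullet> first_service x \<omega> = max_service S x (T 1 \<omega>)"
proof -
  assume \<omega>: "\<omega> \<in> space M"
  obtain s where "s \<in> S (T 1 \<omega>)" "x \<bullet> s = max_service S x (T 1 \<omega>)"
    using max_service_attained[OF channel_in[OF \<omega>]] by metis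
  then show ?thesis
    using first_service_max[OF \<omega>, of s x] max_service_ge[OF channel_in[OF \<omega>] first_service_in[OF \<omega>], of x x] by simp
qed

lemma expected_weight: "(\<integral>\<omega>. x \<bullet> first_service x \<omega> \<partial>M) = (\<Sum>t\<in>\<T>. pmf \<psi> t * max_service S x t)"
proof -
  have "(\<integral>\<omega>. x \<bullet> first_service x \<omega> \<partial>M) = (\<integral>\<omega>. max_service S x (T 1 \<omega>) \<partial>M)"
    by (rule Bochner_Integration.integral_cong[OF refl]) (rule inner_first_service)
  then show ?thesis by (simp only: expectation_channel(2))
qed

text \<open>The steady state is defined by an independent copy of the triple of arrivals, channel state and tie
  breaking. Pulling it back along that triple places everything that happens in a slot on
  \<open>\<mu> \<Otimes>\<^sub>M M\<close>.\<close>
lemma stationary_slot: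
  assumes \<mu>: "prob_space \<mu>" "sets \<mu> = sets borel" and st: "steady_state_law M \<T> a T U rule \<mu>"
  shows "distr (\<mu> \<Otimes>\<^sub>M M) borel (\<lambda>(x, \<omega>). queue_step x (a 1 \<omega>) (first_service x \<omega>)) = \<mu>"
proof -
  interpret \<mu>: prob_space \<mu> by fact
  note [measurable_cong] = \<mu>(2)
  let ?R = "borel \<Otimes>\<^sub>M count_space \<T> \<Otimes>\<^sub>M borel :: ((real ^ 'n) \<times> 't \<times> real) measure"
  let ?X = "\<lambda>\<omega>. (a 1 \<omega>, T 1 \<omega>, U 1 \<omega>)"
  let ?H = "\<lambda>(x, \<alpha>, t, u). queue_step x \<alpha> (rule t x u)"
  have X [measurable]: "?X \<in> M \<rightarrow>\<^sub>M ?R" by measurable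
  have "(\<lambda>z. (\<lambda>t z. rule t (fst z) (snd (snd (snd z)))) (fst (snd (snd z))) z) \<in> borel_measurable (borel \<Otimes>\<^sub>M ?R)"
  proof (rule measurable_compose_countable'[where I = \<T>])
    fix t assume t: "t \<in> \<T>"
    have "(\<lambda>z. (\<lambda>(x, u). rule t x u) (fst z, snd (snd (snd z)))) \<in> borel_measurable (borel \<Otimes>\<^sub>M ?R)"
      by (rule measurable_compose[OF _ rule_measurable[OF t]]) measurable
    then show "(\<lambda>z. rule t (fst z) (snd (snd (snd z)))) \<in> borel_measurable (borel \<Otimes>\<^sub>M ?R)" by simp
  qed (use finite_channels in \<open>auto intro: countable_finite\<close>)
  then have H [measurable]: "?H \<in> borel_measurable (borel \<Otimes>\<^sub>M ?R)"
    unfolding case_prod_beta by (intro queue_step_measurable) measurable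
  interpret RX: prob_space "distr M ?R ?X" by (rule prob_space_distr) fact
  have "distr \<mu> \<mu> (\<lambda>x. x) \<Otimes>\<^sub>M distr M ?R ?X = distr (\<mu> \<Otimes>\<^sub>M M) (\<mu> \<Otimes>\<^sub>M ?R) (\<lambda>(x, \<omega>). (x, ?X \<omega>))"
    using RX.sigma_finite_measure_axioms by (intro pair_measure_distr X) auto
  then have "\<mu> \<Otimes>\<^sub>M distr M ?R ?X = distr (\<mu> \<Otimes>\<^sub>M M) (\<mu> \<Otimes>\<^sub>M ?R) (\<lambda>(x, \<omega>). (x, ?X \<omega>))"
    by (simp add: distr_id2)
  then have "\<mu> = distr (distr (\<mu> \<Otimes>\<^sub>M M) (\<mu> \<Otimes>\<^sub>M ?R) (\<lambda>(x, \<omega>). (x, ?X \<omega>))) borel ?H"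
    using st unfolding steady_state_law_def by simp
  also have "\<dots> = distr (\<mu> \<Otimes>\<^sub>M M) borel (?H \<circ> (\<lambda>(x, \<omega>). (x, ?X \<omega>)))"
    by (rule distr_distr) measurable
  also have "?H \<circ> (\<lambda>(x, \<omega>). (x, ?X \<omega>)) = (\<lambda>(x, \<omega>). queue_step x (a 1 \<omega>) (first_service x \<omega>))"
    by (auto simp: first_service_def)
  finally show ?thesis by simp
qed

lemma arrival_nonneg: "\<omega> \<in> space M \<Longrightarrow> 0 \<le> a 1 \<omega>"
  unfolding less_eq_vec_def
proof
  fix i assume "\<omega> \<in> space M"
  then have "a 1 \<omega> $ i \<in> \<nat>" using arrival_range[of 1 \<omega>] by simp
  then show "0 $ i \<le> a 1 \<omega> $ i" by (auto elim: Nats_cases)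
qed

lemma arrival_bound: "\<omega> \<in> space M \<Longrightarrow> norm (a 1 \<omega>) \<le> CARD('n) * A_max"
proof -
  assume \<omega>: "\<omega> \<in> space M"
  have "norm (a 1 \<omega>) \<le> (\<Sum>i\<in>UNIV. \<bar>a 1 \<omega> $ i\<bar>)" by (rule norm_le_l1_cart)
  also have "\<dots> \<le> (\<Sum>i\<in>(UNIV :: 'n set). A_max)"
    using arrival_range[of 1 \<omega>] arrival_nonneg[OF \<omega>] \<omega> by (intro sum_mono) (auto simp: less_eq_vec_def)
  finally show ?thesis by simp
qed

lemma integrable_arrival: "integrable M (a 1)"
  using arrival_bound by (intro integrable_const_bound[of _ "CARD('n) * A_max"]) auto

text \<open>\<open>indep_var\<close> relates variables of the same type, hence the statement for real functions of the arrivals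
  and of the channel state.\<close>
lemma arrival_channel_indep:
  fixes f :: "real ^ 'n \<Rightarrow> real" and g :: "'t \<Rightarrow> real"
  assumes [measurable]: "f \<in> borel_measurable borel"
  shows "indep_var borel (\<lambda>\<omega>. f (a 1 \<omega>)) borel (\<lambda>\<omega>. g (T 1 \<omega>))"
proof -
  let ?F = "\<lambda>j. sets (case j of
             Initial \<Rightarrow> vimage_algebra (space M) (q 1) borel
           | Arrival k \<Rightarrow> vimage_algebra (space M) (a k) borel
           | Channel k \<Rightarrow> vimage_algebra (space M) (T k) (count_space \<T>)
           | Tie k \<Rightarrow> vimage_algebra (space M) (U k) borel)"
  let ?X = "sigma_sets (space M) {(\<lambda>\<omega>. f (a 1 \<omega>)) -` A \<inter> space M |A. A \<in> sets borel}"
  let ?Y = "sigma_sets (space M) {(\<lambda>\<omega>. g (T 1 \<omega>)) -` A \<inter> space M |A. A \<in> sets borel}"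
  have "(\<lambda>\<omega>. f (a 1 \<omega>)) -` A \<inter> space M \<in> ?F (Arrival 1)" if "A \<in> sets borel" for A
  proof -
    have "f -` A \<in> sets borel" using measurable_sets[OF assms that] by simp
    then have "a 1 -` (f -` A) \<inter> space M \<in> ?F (Arrival 1)" by (simp add: in_vimage_algebra)
    then show ?thesis by (simp only: vimage_def mem_Collect_eq)
  qed
  then have X: "?X \<subseteq> ?F (Arrival 1)"
    using sets.sigma_sets_subset[of "{(\<lambda>\<omega>. f (a 1 \<omega>)) -` A \<inter> space M |A. A \<in> sets borel}"
      "vimage_algebra (space M) (a 1) borel"] by auto
  have "(\<lambda>\<omega>. g (T 1 \<omega>)) -` A \<inter> space M \<in> ?F (Channel 1)" for A
  proof -
    have "T 1 -` (g -` A \<inter> \<T>) \<inter> space M \<in> ?F (Channel 1)"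
      unfolding source.case by (rule in_vimage_algebra) simp
    moreover have "T 1 -` (g -` A \<inter> \<T>) \<inter> space M = (\<lambda>\<omega>. g (T 1 \<omega>)) -` A \<inter> space M"
      using channel_in by auto
    ultimately show ?thesis by (simp only:)
  qed
  then have Y: "?Y \<subseteq> ?F (Channel 1)"
    using sets.sigma_sets_subset[of "{(\<lambda>\<omega>. g (T 1 \<omega>)) -` A \<inter> space M |A. A \<in> sets borel}"
      "vimage_algebra (space M) (T 1) (count_space \<T>)"] by auto
  have prod: "prob (A \<inter> B) = prob A * prob B" if "A \<in> ?F (Arrival 1)" "B \<in> ?F (Channel 1)" for A B
  proof -
    let ?A = "\<lambda>j. if j = Arrival 1 then A else B"
    have "prob (\<Inter>j\<in>{Arrival 1, Channel 1}. ?A j) = (\<Prod>j\<in>{Arrival 1, Channel 1}. prob (?A j))"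
      using that by (intro indep_setsD[OF independent]) auto
    then show ?thesis by (simp add: Int_commute mult.commute)
  qed
  have "?F j \<subseteq> events" if "j \<in> {Initial} \<union> Arrival ` {1..} \<union> Channel ` {1..} \<union> Tie ` {1..}" for j
    using independent that unfolding indep_sets_def by (elim conjE) (rule bspec)
  from this[of "Arrival 1"] this[of "Channel 1"]
  have "?F (Arrival 1) \<subseteq> events" "?F (Channel 1) \<subseteq> events" by simp_all
  then have "indep_set ?X ?Y"
    unfolding indep_sets2_eq
  proof (intro conjI ballI)
    fix A B assume "A \<in> ?X" "B \<in> ?Y"
    then show "prob (A \<inter> B) = prob A * prob B" by (intro prod subsetD[OF X] subsetD[OF Y])
  qed (rule order_trans[OF X] order_trans[OF Y], assumption)+
  then show ?thesis
    unfolding indep_var_eq by (intro conjI) measurable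
qed

text \<open>The mixed term vanishes since arrivals and channel states are independent.\<close>
lemma second_moment_noise:
  fixes c :: "real ^ 'n"
  defines "B \<equiv> \<lambda>\<omega>. max_service S c (T 1 \<omega>)"
  shows "(\<integral>\<omega>. (c \<bullet> a 1 \<omega> - B \<omega>)\<^sup>2 \<partial>M) =
    (\<Sum>i\<in>UNIV. \<Sum>j\<in>UNIV. c $ i * c $ j * covariance M (\<lambda>\<omega>. a 1 \<omega> $ i) (\<lambda>\<omega>. a 1 \<omega> $ j))
    + max_service_variance S \<psi> c + (c \<bullet> (\<integral>\<omega>. a 1 \<omega> \<partial>M) - (\<integral>\<omega>. B \<omega> \<partial>M))\<^sup>2"
proof -
  define b where "b = (\<integral>\<omega>. B \<omega> \<partial>M)"
  define \<alpha> where "\<alpha> = (\<integral>\<omega>. a 1 \<omega> \<partial>M)"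
  define X where "X \<omega> = c \<bullet> (a 1 \<omega> - \<alpha>)" for \<omega>
  define Y where "Y \<omega> = B \<omega> - b" for \<omega>
  have [measurable]: "B \<in> borel_measurable M" unfolding B_def by simp
  have XY_meas [measurable]: "X \<in> borel_measurable M" "Y \<in> borel_measurable M"
    unfolding X_def Y_def by measurable
  have comp: "(\<integral>\<omega>. a 1 \<omega> $ i \<partial>M) = \<alpha> $ i" for i
    using integral_bounded_linear[OF bounded_linear_vec_nth integrable_arrival] by (simp add: \<alpha>_def)
  have iX: "integrable M X" and iY: "integrable M Y"
    unfolding X_def Y_def B_def using integrable_arrival expectation_channel(1) by auto
  have EX: "(\<integral>\<omega>. X \<omega> \<partial>M) = 0" and EY: "(\<integral>\<omega>. Y \<omega> \<partial>M) = 0"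
    unfolding X_def Y_def using integrable_arrival expectation_channel(1) prob_space
    by (simp_all add: inner_diff_right \<alpha>_def b_def B_def)
  have indep: "indep_var borel X borel Y"
  proof -
    have "indep_var borel (\<lambda>\<omega>. c \<bullet> (a 1 \<omega> - \<alpha>)) borel (\<lambda>\<omega>. max_service S c (T 1 \<omega>) - b)"
      by (rule arrival_channel_indep) simp
    then show ?thesis by (simp add: X_def[abs_def] Y_def[abs_def] B_def)
  qed
  have iXY: "integrable M (\<lambda>\<omega>. X \<omega> * Y \<omega>)" by (rule indep_var_integrable[OF indep iX iY])
  have EXY: "(\<integral>\<omega>. X \<omega> * Y \<omega> \<partial>M) = 0"
    using indep_var_lebesgue_integral[OF indep iX iY] EX by simp
  have [measurable]: "(\<lambda>\<omega>. a 1 \<omega> $ i) \<in> borel_measurable M" for i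
    by (rule measurable_compose[OF first_slot_measurable(1)])
      (intro borel_measurable_continuous_onI continuous_intros)
  have iab: "integrable M (\<lambda>\<omega>. (a 1 \<omega> $ i - \<alpha> $ i) * (a 1 \<omega> $ j - \<alpha> $ j))" for i j
  proof (rule integrable_const_bound)
    show "AE \<omega> in M. norm ((a 1 \<omega> $ i - \<alpha> $ i) * (a 1 \<omega> $ j - \<alpha> $ j))
      \<le> (CARD('n) * A_max + norm \<alpha>) * (CARD('n) * A_max + norm \<alpha>)"
    proof (rule AE_I2)
      fix \<omega> assume \<omega>: "\<omega> \<in> space M"
      have "\<bar>a 1 \<omega> $ i - \<alpha> $ i\<bar> \<le> CARD('n) * A_max + norm \<alpha>" for i
        using component_le_norm_cart[of "a 1 \<omega> - \<alpha>" i] norm_triangle_ineq4[of "a 1 \<omega>" \<alpha>] arrival_bound[OF \<omega>]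
        by simp
      then show "norm ((a 1 \<omega> $ i - \<alpha> $ i) * (a 1 \<omega> $ j - \<alpha> $ j))
        \<le> (CARD('n) * A_max + norm \<alpha>) * (CARD('n) * A_max + norm \<alpha>)"
        unfolding real_norm_def abs_mult by (intro mult_mono') auto
    qed
  qed measurable
  have X2: "(X \<omega>)\<^sup>2 = (\<Sum>i\<in>UNIV. \<Sum>j\<in>UNIV. c $ i * c $ j * ((a 1 \<omega> $ i - \<alpha> $ i) * (a 1 \<omega> $ j - \<alpha> $ j)))" for \<omega>
    unfolding X_def inner_vec_def power2_eq_square sum_product by (simp add: mult_ac)
  have iX2: "integrable M (\<lambda>\<omega>. (X \<omega>)\<^sup>2)"
    unfolding X2 using iab by (intro Bochner_Integration.integrable_sum integrable_mult_right)
  have EX2: "(\<integral>\<omega>. (X \<omega>)\<^sup>2 \<partial>M)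
    = (\<Sum>i\<in>UNIV. \<Sum>j\<in>UNIV. c $ i * c $ j * covariance M (\<lambda>\<omega>. a 1 \<omega> $ i) (\<lambda>\<omega>. a 1 \<omega> $ j))"
    unfolding X2 covariance_def comp using iab
    by (simp add: Bochner_Integration.integral_sum Bochner_Integration.integrable_sum)
  have mean_b: "b = (\<Sum>t\<in>\<T>. pmf \<psi> t * max_service S c t)"
    unfolding b_def B_def by (rule expectation_channel)
  have iY2: "integrable M (\<lambda>\<omega>. (Y \<omega>)\<^sup>2)"
    unfolding Y_def B_def by (rule expectation_channel(1)[of "\<lambda>t. (max_service S c t - b)\<^sup>2"])
  have EY2: "(\<integral>\<omega>. (Y \<omega>)\<^sup>2 \<partial>M) = max_service_variance S \<psi> c"
  proof -
    have pm: "measure_pmf.expectation \<psi> f = (\<Sum>t\<in>\<T>. pmf \<psi> t * f t)" for f :: "'t \<Rightarrow> real"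
      using integral_measure_pmf_real[OF finite_channels, of \<psi> f] channel_support by (auto simp: mult.commute)
    have "(\<integral>\<omega>. (Y \<omega>)\<^sup>2 \<partial>M) = (\<Sum>t\<in>\<T>. pmf \<psi> t * (max_service S c t - b)\<^sup>2)"
      unfolding Y_def B_def by (rule expectation_channel(2))
    also have "\<dots> = max_service_variance S \<psi> c"
      unfolding max_service_variance_def by (simp add: pm mean_b)
    finally show ?thesis .
  qed
  define d where "d = c \<bullet> \<alpha> - b"
  have sq: "(c \<bullet> a 1 \<omega> - B \<omega>)\<^sup>2 = (X \<omega>)\<^sup>2 + (Y \<omega>)\<^sup>2 - 2 * (X \<omega> * Y \<omega>) + 2 * d * X \<omega> - 2 * d * Y \<omega> + d\<^sup>2" for \<omega>
    unfolding X_def Y_def d_def by (simp add: inner_diff_right power2_eq_square algebra_simps)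
  have "(\<integral>\<omega>. (c \<bullet> a 1 \<omega> - B \<omega>)\<^sup>2 \<partial>M) = (\<integral>\<omega>. (X \<omega>)\<^sup>2 \<partial>M) + (\<integral>\<omega>. (Y \<omega>)\<^sup>2 \<partial>M) + d\<^sup>2"
    unfolding sq using iX iY iXY iX2 iY2 EX EY EXY prob_space by simp
  then show ?thesis unfolding EX2 EY2 d_def \<alpha>_def b_def by simp
qed

text \<open>The gain of MaxWeight is obtained from the point \<open>r + v\<close> of the capacity region, where \<open>v\<close> has
  length \<open>\<delta>\<close> and points in the direction of \<open>perp c x\<close>.\<close>
lemma heavy_traffic_slot_first:
  fixes c r :: "real ^ 'n" and \<mu> :: "(real ^ 'n) measure"
  assumes \<mu>: "prob_space \<mu>" "sets \<mu> = sets borel" and st: "steady_state_law M \<T> a T U rule \<mu>"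
    and mean: "(\<integral>\<omega>. a 1 \<omega> \<partial>M) = r - \<epsilon> *\<^sub>R c"
    and c: "0 \<le> c" "norm c = 1" and \<epsilon>: "0 < \<epsilon>" "\<epsilon> < 1"
    and \<delta>: "0 < \<delta>" "\<And>v. c \<bullet> v = 0 \<Longrightarrow> norm v \<le> \<delta> \<Longrightarrow> r + v \<in> capacity_region \<T> S \<psi>"
    and r: "c \<bullet> r = (\<Sum>t\<in>\<T>. pmf \<psi> t * max_service S c t)"
    and K: "CARD('n) * A_max \<le> K" "\<And>t s. t \<in> \<T> \<Longrightarrow> s \<in> S t \<Longrightarrow> norm s \<le> K"
    and \<kappa>: "0 \<le> \<kappa>" "\<And>i. c $ i = 0 \<or> 1 \<le> \<kappa> * c $ i"
    "\<And>t s x. t \<in> \<T> \<Longrightarrow> s \<in> S t \<Longrightarrow> \<forall>s'\<in>S t. x \<bullet> s' \<le> x \<bullet> s \<Longrightarrow>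
       (c \<bullet> x) * (max_service S c t - c \<bullet> s) \<le> \<kappa> * (max_service S c t - c \<bullet> s) * norm (perp c x)"
  shows "heavy_traffic_slot \<mu> M (a 1) first_service (\<lambda>\<omega>. max_service S c (T 1 \<omega>)) c r \<epsilon> \<delta> K \<kappa>"
proof -
  interpret \<mu>: prob_space \<mu> by fact
  interpret pair_prob_space \<mu> M ..
  show ?thesis
  proof unfold_locales
    fix \<omega> assume \<omega>: "\<omega> \<in> space M"
    note t = channel_in[OF \<omega>]
    show "0 \<le> a 1 \<omega>" by (rule arrival_nonneg[OF \<omega>])
    show "norm (a 1 \<omega>) \<le> K" using arrival_bound[OF \<omega>] K(1) by simp
    show "0 \<le> first_service x \<omega>" for x by (rule services_nonneg[OF t first_service_in[OF \<omega>]])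
    show "norm (first_service x \<omega>) \<le> K" for x by (rule K(2)[OF t first_service_in[OF \<omega>]])
    show "c \<bullet> first_service x \<omega> \<le> max_service S c (T 1 \<omega>)" for x by (rule max_service_ge[OF t first_service_in[OF \<omega>]])
    obtain s where "s \<in> S (T 1 \<omega>)" "c \<bullet> s = max_service S c (T 1 \<omega>)" using max_service_attained[OF t] by metis
    then show "max_service S c (T 1 \<omega>) \<le> K"
      using K(2)[OF t, of s] inner_nonneg_le_norm[OF c(2), of s] by linarith
    show "(c \<bullet> x) * (max_service S c (T 1 \<omega>) - c \<bullet> first_service x \<omega>)
        \<le> \<kappa> * (max_service S c (T 1 \<omega>) - c \<bullet> first_service x \<omega>) * norm (perp c x)" for x
      using first_service_max[OF \<omega>] by (intro \<kappa>(3) t first_service_in \<omega> ballI)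
  next
    fix x :: "real ^ 'n"
    define v where "v = \<delta> *\<^sub>R sgn (perp c x)"
    have "c \<bullet> v = 0" using c(2) by (simp add: v_def sgn_div_norm inner_perp_self)
    moreover have "norm v \<le> \<delta>" using \<delta>(1) by (simp add: v_def norm_sgn)
    ultimately have "x \<bullet> (r + v) \<le> (\<Sum>t\<in>\<T>. pmf \<psi> t * max_service S x t)"
      by (intro inner_capacity_le \<delta>(2))
    moreover have "x \<bullet> v = \<delta> * norm (perp c x)"
    proof -
      have "x \<bullet> perp c x = (norm (perp c x))\<^sup>2"
        using perp_inner_perp[OF c(2), of x x] by (simp add: power2_norm_eq_inner inner_commute)
      then show ?thesis by (cases "perp c x = 0") (simp_all add: v_def sgn_div_norm power2_eq_square)
    qed
    ultimately show "x \<bullet> r + \<delta> * norm (perp c x) \<le> (\<integral>\<omega>. x \<bullet> first_service x \<omega> \<partial>M)"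
      by (simp add: expected_weight inner_add_right)
  next
    show "(\<integral>\<omega>. max_service S c (T 1 \<omega>) \<partial>M) = c \<bullet> r"
      by (simp only: expectation_channel(2) r)
    show "distr (\<mu> \<Otimes>\<^sub>M M) borel (\<lambda>(x, \<omega>). queue_step x (a 1 \<omega>) (first_service x \<omega>)) = \<mu>"
      by (rule stationary_slot[OF \<mu> st])
    show "(\<lambda>(x, \<omega>). first_service x \<omega>) \<in> borel_measurable (borel \<Otimes>\<^sub>M M)" by (rule first_service_measurable)
    show "a 1 \<in> borel_measurable M" "(\<lambda>\<omega>. max_service S c (T 1 \<omega>)) \<in> borel_measurable M" by measurable
  qed fact+
qed

end

end

section \<open>Heavy-traffic limit\<close>

theorem theorem3:
  fixes \<T> :: "'t set"
    and S :: "'t \<Rightarrow> (real ^ 'n) set"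
    and \<psi> :: "'t pmf"
    and L l :: nat
    and c :: "nat \<Rightarrow> real ^ 'n"
    and b :: "nat \<Rightarrow> real"
    and r :: "real ^ 'n"
    and A_max :: real
    and M :: "real \<Rightarrow> 'w measure"
    and a :: "real \<Rightarrow> nat \<Rightarrow> 'w \<Rightarrow> real ^ 'n"
    and T :: "real \<Rightarrow> nat \<Rightarrow> 'w \<Rightarrow> 't"
    and U :: "real \<Rightarrow> nat \<Rightarrow> 'w \<Rightarrow> real"
    and rule :: "real \<Rightarrow> 't \<Rightarrow> real ^ 'n \<Rightarrow> real \<Rightarrow> real ^ 'n"
    and s q :: "real \<Rightarrow> nat \<Rightarrow> 'w \<Rightarrow> real ^ 'n"
    and N :: "real \<Rightarrow> 'v measure"
    and qbar :: "real \<Rightarrow> 'v \<Rightarrow> real ^ 'n"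
    and Cov :: "'n \<Rightarrow> 'n \<Rightarrow> real"
  assumes services: "service_structure \<T> S \<psi>"
    and description: "minimal_halfspace_description (capacity_region \<T> S \<psi>) L c b"
    and l: "l \<in> {1..L}"
    and r: "r \<in> rel_interior (facet (capacity_region \<T> S \<psi>) (c l) (b l))"
    and switch: "\<And>\<epsilon>. 0 < \<epsilon> \<Longrightarrow> \<epsilon> < 1 \<Longrightarrow>
      maxweight_switch (M \<epsilon>) \<T> S \<psi> A_max (a \<epsilon>) (T \<epsilon>) (U \<epsilon>) (rule \<epsilon>) (s \<epsilon>) (q \<epsilon>)"
    and mean: "\<And>\<epsilon> k. 0 < \<epsilon> \<Longrightarrow> \<epsilon> < 1 \<Longrightarrow> 1 \<le> k \<Longrightarrow>
      (\<integral>\<omega>. a \<epsilon> k \<omega> \<partial>M \<epsilon>) = r - \<epsilon> *\<^sub>R c l"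
    and qbar: "\<And>\<epsilon>. 0 < \<epsilon> \<Longrightarrow> \<epsilon> < 1 \<Longrightarrow>
      prob_space (N \<epsilon>) \<and> qbar \<epsilon> \<in> borel_measurable (N \<epsilon>)"
    and steady_state: "\<And>\<epsilon>. 0 < \<epsilon> \<Longrightarrow> \<epsilon> < 1 \<Longrightarrow>
      steady_state_law (M \<epsilon>) \<T> (a \<epsilon>) (T \<epsilon>) (U \<epsilon>) (rule \<epsilon>) (distr (N \<epsilon>) borel (qbar \<epsilon>))"
    and convergence: "\<And>\<epsilon>. 0 < \<epsilon> \<Longrightarrow> \<epsilon> < 1 \<Longrightarrow>
      converges_weakly (\<lambda>k. distr (M \<epsilon>) borel (q \<epsilon> k)) (distr (N \<epsilon>) borel (qbar \<epsilon>)) sequentially"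
    and cov_limit: "\<And>i j.
      ((\<lambda>\<epsilon>. covariance (M \<epsilon>) (\<lambda>\<omega>. a \<epsilon> 1 \<omega> $ i) (\<lambda>\<omega>. a \<epsilon> 1 \<omega> $ j)) \<longlongrightarrow> Cov i j) (at_right 0)"
  shows "converges_weakly
    (\<lambda>\<epsilon>. distr (N \<epsilon>) borel (\<lambda>\<omega>. \<epsilon> *\<^sub>R qbar \<epsilon> \<omega>))
    (distr
      (exponential_law
        (1 / 2 * ((\<Sum>i\<in>UNIV. \<Sum>j\<in>UNIV. c l $ i * c l $ j * Cov i j) + max_service_variance S \<psi> (c l))))
      borel (\<lambda>y. y *\<^sub>R c l))
    (at_right 0)"
proof -
  interpret service_structure \<T> S \<psi> by (rule services)
  define d where "d = c l"
  define \<mu> where "\<mu> \<epsilon> = distr (N \<epsilon>) borel (qbar \<epsilon>)" for \<epsilon>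
  define m where "m = 1 / 2 * ((\<Sum>i\<in>UNIV. \<Sum>j\<in>UNIV. d $ i * d $ j * Cov i j) + max_service_variance S \<psi> d)"
  have unit_range: "eventually P (at_right 0)" if "\<And>\<epsilon>. 0 < \<epsilon> \<Longrightarrow> \<epsilon> < 1 \<Longrightarrow> P \<epsilon>" for P :: "real \<Rightarrow> bool"
    using that unfolding eventually_at_right_field by (intro exI[of _ 1]) auto
  have desc: "halfspace_description (capacity_region \<T> S \<psi>) L c b"
    using description by (simp add: minimal_halfspace_description_def)
  have d: "0 \<le> d" "norm d = 1" using desc l by (auto simp: halfspace_description_def d_def)
  have rF: "r \<in> capacity_region \<T> S \<psi>" "d \<bullet> r = b l"
    using r rel_interior_subset[of "facet (capacity_region \<T> S \<psi>) (c l) (b l)"]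
    by (auto simp: facet_def d_def)
  \<comment> \<open>The hyperplane of the facet supports the capacity region, so \<open>r\<close> maximizes \<open>d \<bullet> x\<close> over it.\<close>
  have dr: "d \<bullet> r = (\<Sum>t\<in>\<T>. pmf \<psi> t * max_service S d t)"
  proof (rule antisym)
    show "d \<bullet> r \<le> (\<Sum>t\<in>\<T>. pmf \<psi> t * max_service S d t)" by (rule inner_capacity_le[OF rF(1)])
    obtain z where "z \<in> capacity_region \<T> S \<psi>" "d \<bullet> z = (\<Sum>t\<in>\<T>. pmf \<psi> t * max_service S d t)"
      by (rule max_service_sum_attained)
    then show "(\<Sum>t\<in>\<T>. pmf \<psi> t * max_service S d t) \<le> d \<bullet> r"
      using desc l rF(2) unfolding halfspace_description_def d_def by (metis (no_types, lifting) mem_Collect_eq)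
  qed
  obtain \<delta> where \<delta>: "0 < \<delta>" "\<And>v. d \<bullet> v = 0 \<Longrightarrow> norm v \<le> \<delta> \<Longrightarrow> r + v \<in> capacity_region \<T> S \<psi>"
    using facet_interior_point[OF description l r] unfolding d_def by metis
  obtain \<kappa> where \<kappa>: "0 \<le> \<kappa>" "\<And>i. d $ i = 0 \<or> 1 \<le> \<kappa> * d $ i"
    "\<And>t s x. t \<in> \<T> \<Longrightarrow> s \<in> S t \<Longrightarrow> \<forall>s'\<in>S t. x \<bullet> s' \<le> x \<bullet> s \<Longrightarrow>
       (d \<bullet> x) * (max_service S d t - d \<bullet> s) \<le> \<kappa> * (max_service S d t - d \<bullet> s) * norm (perp d x)"
    by (rule alignment_constant[OF d(2,1)]) (rule that; blast)
  obtain K0 where K0: "\<And>t s. t \<in> \<T> \<Longrightarrow> s \<in> S t \<Longrightarrow> norm s \<le> K0" using services_bounded by metis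
  define K where "K = max K0 (CARD('n) * A_max)"
  have K: "CARD('n) * A_max \<le> K" "\<And>t s. t \<in> \<T> \<Longrightarrow> s \<in> S t \<Longrightarrow> norm s \<le> K"
    using K0 by (auto simp: K_def intro: max.coboundedI1)
  have \<mu>: "prob_space (\<mu> \<epsilon>)" "sets (\<mu> \<epsilon>) = sets borel" if "0 < \<epsilon>" "\<epsilon> < 1" for \<epsilon>
    using qbar[OF that] unfolding \<mu>_def by (auto intro: prob_space.prob_space_distr)
  define B where "B \<epsilon> \<omega> = max_service S d (T \<epsilon> 1 \<omega>)" for \<epsilon> \<omega>
  define \<sigma> where "\<sigma> \<epsilon> = (\<integral>\<omega>. (d \<bullet> a \<epsilon> 1 \<omega> - B \<epsilon> \<omega>)\<^sup>2 \<partial>M \<epsilon>)" for \<epsilon>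
  \<comment> \<open>The constants \<open>\<delta>\<close>, \<open>K\<close> and \<open>\<kappa>\<close> come from the facet, the service structure and the bound on the
    arrivals; hence one choice serves the whole family.\<close>
  have slot: "heavy_traffic_slot (\<mu> \<epsilon>) (M \<epsilon>) (a \<epsilon> 1) (maxweight_switch.first_service (T \<epsilon>) (U \<epsilon>) (rule \<epsilon>)) (B \<epsilon>) d r \<epsilon> \<delta> K \<kappa>"
    if \<epsilon>: "0 < \<epsilon>" "\<epsilon> < 1" for \<epsilon>
    unfolding B_def
  proof (rule maxweight_switch.heavy_traffic_slot_first[OF switch[OF \<epsilon>] \<mu>[OF \<epsilon>]])
    show "steady_state_law (M \<epsilon>) \<T> (a \<epsilon>) (T \<epsilon>) (U \<epsilon>) (rule \<epsilon>) (\<mu> \<epsilon>)"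
      unfolding \<mu>_def by (rule steady_state[OF \<epsilon>])
    show "(\<integral>\<omega>. a \<epsilon> 1 \<omega> \<partial>M \<epsilon>) = r - \<epsilon> *\<^sub>R d" unfolding d_def by (rule mean[OF \<epsilon>]) simp
  qed (fact d \<epsilon> \<delta> dr K \<kappa>)+
  \<comment> \<open>The net input has mean \<open>- \<epsilon>\<close>, so its second moment exceeds its variance by \<open>\<epsilon>\<^sup>2\<close> only.\<close>
  have \<sigma>_eq: "\<sigma> \<epsilon> = (\<Sum>i\<in>UNIV. \<Sum>j\<in>UNIV. d $ i * d $ j * covariance (M \<epsilon>) (\<lambda>\<omega>. a \<epsilon> 1 \<omega> $ i) (\<lambda>\<omega>. a \<epsilon> 1 \<omega> $ j))
      + max_service_variance S \<psi> d + \<epsilon>\<^sup>2" if \<epsilon>: "0 < \<epsilon>" "\<epsilon> < 1" for \<epsilon>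
  proof -
    have "d \<bullet> (\<integral>\<omega>. a \<epsilon> 1 \<omega> \<partial>M \<epsilon>) - (\<integral>\<omega>. max_service S d (T \<epsilon> 1 \<omega>) \<partial>M \<epsilon>) = - \<epsilon>"
      using mean[OF \<epsilon>, of 1] maxweight_switch.expectation_channel(2)[OF switch[OF \<epsilon>], of "max_service S d"] d(2)
      by (simp add: dr[symmetric] d_def[symmetric] inner_diff_right dot_square_norm)
    then show ?thesis
      unfolding \<sigma>_def B_def maxweight_switch.second_moment_noise[OF switch[OF \<epsilon>]] by simp
  qed
  have "((\<lambda>\<epsilon>. (\<Sum>i\<in>UNIV. \<Sum>j\<in>UNIV. d $ i * d $ j * covariance (M \<epsilon>) (\<lambda>\<omega>. a \<epsilon> 1 \<omega> $ i) (\<lambda>\<omega>. a \<epsilon> 1 \<omega> $ j))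
      + max_service_variance S \<psi> d + \<epsilon>\<^sup>2) \<longlongrightarrow>
      (\<Sum>i\<in>UNIV. \<Sum>j\<in>UNIV. d $ i * d $ j * Cov i j) + max_service_variance S \<psi> d + 0\<^sup>2) (at_right 0)"
    by (intro tendsto_intros cov_limit)
  then have "(\<sigma> \<longlongrightarrow> (\<Sum>i\<in>UNIV. \<Sum>j\<in>UNIV. d $ i * d $ j * Cov i j) + max_service_variance S \<psi> d + 0\<^sup>2) (at_right 0)"
    by (rule Lim_transform_eventually) (auto intro!: unit_range simp: \<sigma>_eq)
  moreover have "(\<Sum>i\<in>UNIV. \<Sum>j\<in>UNIV. d $ i * d $ j * Cov i j) + max_service_variance S \<psi> d + 0\<^sup>2 = 2 * m"
    by (simp add: m_def field_simps)
  ultimately have \<sigma>_lim: "(\<sigma> \<longlongrightarrow> 2 * m) (at_right 0)" by (simp only:)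
  \<comment> \<open>\<open>Cov\<close> enters as a limit of covariances, which makes the quadratic form in \<open>m\<close> nonnegative.\<close>
  have "0 \<le> 2 * m"
    by (rule tendsto_lowerbound[OF \<sigma>_lim]) (auto simp: \<sigma>_def)
  then have m: "0 \<le> m" by simp
  define \<nu> where "\<nu> \<epsilon> = distr (\<mu> \<epsilon>) borel (\<lambda>x. \<epsilon> * (d \<bullet> x))" for \<epsilon>
  have inner_meas: "(\<lambda>x. \<epsilon> * (d \<bullet> x)) \<in> \<mu> \<epsilon> \<rightarrow>\<^sub>M borel" if "0 < \<epsilon>" "\<epsilon> < 1" for \<epsilon>
  proof -
    note [measurable_cong] = \<mu>(2)[OF that]
    show ?thesis by measurable
  qed
  have \<nu>: "real_distribution (\<nu> \<epsilon>)" if "0 < \<epsilon>" "\<epsilon> < 1" for \<epsilon>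
    using prob_space.prob_space_distr[OF \<mu>(1)[OF that] inner_meas[OF that]]
    by (simp add: \<nu>_def real_distribution_def real_distribution_axioms_def)
  have char_\<nu>: "((\<lambda>\<epsilon>. char (\<nu> \<epsilon>) \<theta>) \<longlongrightarrow> char (exponential_law m) \<theta>) (at_right 0)" for \<theta>
  proof (cases "\<theta> = 0")
    case True
    have "\<forall>\<^sub>F \<epsilon> in at_right 0. 1 = char (\<nu> \<epsilon>) 0"
      by (rule unit_range) (use real_distribution.char_zero[OF \<nu>] in simp)
    then have "((\<lambda>\<epsilon>. char (\<nu> \<epsilon>) 0) \<longlongrightarrow> 1) (at_right 0)"
      by (rule Lim_transform_eventually[OF tendsto_const])
    then show ?thesis using True by (simp add: char_exponential_law[OF m])
  next
    case False
    let ?R = "\<lambda>\<epsilon>. char (\<nu> \<epsilon>) \<theta> * (\<i> * \<theta> + \<theta>\<^sup>2 * \<sigma> \<epsilon> / 2) - \<i> * \<theta>"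
    have "((\<lambda>\<epsilon>. (\<theta>\<^sup>2 * transform_error \<delta> K \<kappa> + \<bar>\<theta>\<bar>^3 * K^3) * sqrt \<epsilon>) \<longlongrightarrow>
        (\<theta>\<^sup>2 * transform_error \<delta> K \<kappa> + \<bar>\<theta>\<bar>^3 * K^3) * sqrt 0) (at_right 0)"
      by (intro tendsto_intros)
    then have "((\<lambda>\<epsilon>. (\<theta>\<^sup>2 * transform_error \<delta> K \<kappa> + \<bar>\<theta>\<bar>^3 * K^3) * sqrt \<epsilon>) \<longlongrightarrow> 0) (at_right 0)" by simp
    moreover have "\<forall>\<^sub>F \<epsilon> in at_right 0. norm (?R \<epsilon>) \<le> (\<theta>\<^sup>2 * transform_error \<delta> K \<kappa> + \<bar>\<theta>\<bar>^3 * K^3) * sqrt \<epsilon>"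
    proof (rule unit_range)
      fix \<epsilon> :: real assume \<epsilon>: "0 < \<epsilon>" "\<epsilon> < 1"
      have "char (\<nu> \<epsilon>) \<theta> = heavy_traffic_slot.\<phi> (\<mu> \<epsilon>) d (\<epsilon> * \<theta>)"
        unfolding char_def \<nu>_def heavy_traffic_slot.\<phi>_def[OF slot[OF \<epsilon>]]
        by (subst integral_distr[OF inner_meas[OF \<epsilon>]]) (simp_all add: mult_ac)
      then show "norm (?R \<epsilon>) \<le> (\<theta>\<^sup>2 * transform_error \<delta> K \<kappa> + \<bar>\<theta>\<bar>^3 * K^3) * sqrt \<epsilon>"
        using heavy_traffic_slot.transform_estimate[OF slot[OF \<epsilon>], of \<theta>]
        by (simp only: \<sigma>_def heavy_traffic_slot.net_input_def[OF slot[OF \<epsilon>]])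
    qed
    ultimately have "(?R \<longlongrightarrow> 0) (at_right 0)" by (rule Lim_null_comparison[rotated])
    then show ?thesis unfolding char_exponential_law[OF m] by (rule transform_limit[OF _ \<sigma>_lim False])
  qed
  show ?thesis
    unfolding converges_weakly_def
  proof (intro allI impI)
    fix f :: "real ^ 'n \<Rightarrow> real"
    assume f: "continuous_on UNIV f" "bounded (range f)"
    then obtain Bd where Bd: "\<And>x. \<bar>f x\<bar> \<le> Bd" unfolding bounded_iff by auto
    have [measurable]: "f \<in> borel_measurable borel" using f(1) by (rule borel_measurable_continuous_onI)
    have cont: "continuous_on UNIV (\<lambda>y. f (y *\<^sub>R d))"
      by (intro continuous_on_compose2[OF f(1)] continuous_intros) auto
    have "((\<lambda>\<epsilon>. \<integral>y. f (y *\<^sub>R d) \<partial>\<nu> \<epsilon>) \<longlongrightarrow> (\<integral>y. f (y *\<^sub>R d) \<partial>exponential_law m)) (at_right 0)"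
      by (rule levy_continuity_at_right[OF \<nu> exponential_law_real_distribution[OF m] char_\<nu> cont Bd])
    moreover have "((\<lambda>\<epsilon>. (\<integral>x. f (\<epsilon> *\<^sub>R x) \<partial>\<mu> \<epsilon>) - (\<integral>x. f ((\<epsilon> * (d \<bullet> x)) *\<^sub>R d) \<partial>\<mu> \<epsilon>)) \<longlongrightarrow> 0) (at_right 0)"
    proof (rule collapse_onto_line[OF f(1) Bd d(2), where ?D1.0 = "2 * K\<^sup>2" and ?D2.0 = "2 * K\<^sup>2 / \<delta>"])
      fix \<epsilon> :: real assume \<epsilon>: "0 < \<epsilon>" "\<epsilon> < 1"
      interpret heavy_traffic_slot "\<mu> \<epsilon>" "M \<epsilon>" "a \<epsilon> 1" "maxweight_switch.first_service (T \<epsilon>) (U \<epsilon>) (rule \<epsilon>)"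
        "B \<epsilon>" d r \<epsilon> \<delta> K \<kappa> by (rule slot[OF \<epsilon>])
      have "AE x in \<mu> \<epsilon>. \<bar>d \<bullet> x\<bar> = d \<bullet> x"
        using AE_nonneg by eventually_elim (use inner_nonneg_vec[OF d(1)] in auto)
      then have "(\<integral>x. \<bar>d \<bullet> x\<bar> \<partial>\<mu> \<epsilon>) = (\<integral>x. d \<bullet> x \<partial>\<mu> \<epsilon>)"
        using integrable_workload by (intro integral_cong_AE) auto
      then show "integrable (\<mu> \<epsilon>) (\<lambda>x. \<bar>d \<bullet> x\<bar>) \<and> \<epsilon> * (\<integral>x. \<bar>d \<bullet> x\<bar> \<partial>\<mu> \<epsilon>) \<le> 2 * K\<^sup>2"
        using integrable_workload workload_bound by auto
      show "integrable (\<mu> \<epsilon>) (\<lambda>x. norm (perp d x)) \<and> (\<integral>x. norm (perp d x) \<partial>\<mu> \<epsilon>) \<le> 2 * K\<^sup>2 / \<delta>"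
        using integrable_perp perp_bound \<delta>(1) by (simp add: pos_le_divide_eq mult.commute)
      show "prob_space (\<mu> \<epsilon>) \<and> sets (\<mu> \<epsilon>) = sets borel" using \<mu>[OF \<epsilon>] by simp
    qed
    ultimately have "((\<lambda>\<epsilon>. ((\<integral>x. f (\<epsilon> *\<^sub>R x) \<partial>\<mu> \<epsilon>) - (\<integral>x. f ((\<epsilon> * (d \<bullet> x)) *\<^sub>R d) \<partial>\<mu> \<epsilon>)) + (\<integral>y. f (y *\<^sub>R d) \<partial>\<nu> \<epsilon>))
        \<longlongrightarrow> 0 + (\<integral>y. f (y *\<^sub>R d) \<partial>exponential_law m)) (at_right 0)"
      by (intro tendsto_add)
    moreover have "\<forall>\<^sub>F \<epsilon> in at_right 0.
        ((\<integral>x. f (\<epsilon> *\<^sub>R x) \<partial>\<mu> \<epsilon>) - (\<integral>x. f ((\<epsilon> * (d \<bullet> x)) *\<^sub>R d) \<partial>\<mu> \<epsilon>)) + (\<integral>y. f (y *\<^sub>R d) \<partial>\<nu> \<epsilon>)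
        = (\<integral>x. f x \<partial>distr (N \<epsilon>) borel (\<lambda>\<omega>. \<epsilon> *\<^sub>R qbar \<epsilon> \<omega>))"
    proof (rule unit_range)
      fix \<epsilon> :: real assume \<epsilon>: "0 < \<epsilon>" "\<epsilon> < 1"
      have [measurable]: "qbar \<epsilon> \<in> borel_measurable (N \<epsilon>)" using qbar[OF \<epsilon>] by simp
      have "(\<integral>y. f (y *\<^sub>R d) \<partial>\<nu> \<epsilon>) = (\<integral>x. f ((\<epsilon> * (d \<bullet> x)) *\<^sub>R d) \<partial>\<mu> \<epsilon>)"
        unfolding \<nu>_def by (subst integral_distr[OF inner_meas[OF \<epsilon>]]) simp_all
      moreover have "(\<integral>x. f x \<partial>distr (N \<epsilon>) borel (\<lambda>\<omega>. \<epsilon> *\<^sub>R qbar \<epsilon> \<omega>)) = (\<integral>x. f (\<epsilon> *\<^sub>R x) \<partial>\<mu> \<epsilon>)"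
        unfolding \<mu>_def by (simp add: integral_distr)
      ultimately show "((\<integral>x. f (\<epsilon> *\<^sub>R x) \<partial>\<mu> \<epsilon>) - (\<integral>x. f ((\<epsilon> * (d \<bullet> x)) *\<^sub>R d) \<partial>\<mu> \<epsilon>)) + (\<integral>y. f (y *\<^sub>R d) \<partial>\<nu> \<epsilon>)
        = (\<integral>x. f x \<partial>distr (N \<epsilon>) borel (\<lambda>\<omega>. \<epsilon> *\<^sub>R qbar \<epsilon> \<omega>))" by simp
    qed
    ultimately have "((\<lambda>\<epsilon>. \<integral>x. f x \<partial>distr (N \<epsilon>) borel (\<lambda>\<omega>. \<epsilon> *\<^sub>R qbar \<epsilon> \<omega>))
        \<longlongrightarrow> 0 + (\<integral>y. f (y *\<^sub>R d) \<partial>exponential_law m)) (at_right 0)"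
      by (rule Lim_transform_eventually)
    moreover have "(\<integral>x. f x \<partial>distr (exponential_law m) borel (\<lambda>y. y *\<^sub>R d)) = (\<integral>y. f (y *\<^sub>R d) \<partial>exponential_law m)"
    proof -
      interpret E: real_distribution "exponential_law m" by (rule exponential_law_real_distribution[OF m])
      show ?thesis by (rule integral_distr) simp_all
    qed
    ultimately show "((\<lambda>\<epsilon>. \<integral>x. f x \<partial>distr (N \<epsilon>) borel (\<lambda>\<omega>. \<epsilon> *\<^sub>R qbar \<epsilon> \<omega>)) \<longlongrightarrow>
      (\<integral>x. f x \<partial>distr (exponential_law (1 / 2 * ((\<Sum>i\<in>UNIV. \<Sum>j\<in>UNIV. c l $ i * c l $ j * Cov i j)
        + max_service_variance S \<psi> (c l)))) borel (\<lambda>y. y *\<^sub>R c l))) (at_right 0)"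
      unfolding m_def d_def by simp
  qed
qed

end
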